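(* Let $f,g:\mathbb{R}^n\times\mathbb{R}^m\to\mathbb{R}^n$, with $f$ locally Lipschitz with respect to its first argument and $f(0,0)=g(0,0)=0$. Consider the impulsive system $$\dot x(t)=f(x(t),u(t)),\ t\in[t_0,\infty)\setminus T,\qquad x(t)=g(x^-(t),u^-(t)),\ t\in T. \qquad (\ast)$$ Let $V$ be an ISS-Lyapunov function for $(\ast)$, with associated functions $\varphi$ (continuous, $\varphi(0)=0$) and $\alpha\in\mathcal{P}$ as in the definition of an ISS-Lyapunov function, and suppose that $\varphi\in\mathcal{P}$. Suppose that for some $\theta,\delta>0$ and all $a>0$ it holds that $$\int_a^{\alpha(a)}\frac{ds}{\varphi(s)}\le\theta-\delta.$$ Then $(\ast)$ is input-to-state stable (ISS) for every impulse time sequence $T\in S_\theta$, where $S_\theta:=\{\{t_i\}_{i=1}^\infty\subset[t_0,\infty): t_{i+1}-t_i\ge\theta\ \text{for all } i\in\mathbb{N}\}$.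
   Context: Notation: $\mathbb{R}_+=[0,\infty)$, $\mathbb{N}=\{1,2,3,\dots\}$, and $|\cdot|$ is the Euclidean norm. Function classes: - $\mathcal{P}$: continuous $\gamma:\mathbb{R}_+\to\mathbb{R}_+$ with $\gamma(0)=0$ and $\gamma(r)>0$ for $r>0$. - $\mathcal{K}$: strictly increasing $\gamma\in\mathcal{P}$. - $\mathcal{K}_\infty$: unbounded $\gamma\in\mathcal{K}$. - $\mathcal{L}$: continuous strictly decreasing $\gamma:\mathbb{R}_+\to\mathbb{R}_+$ with $\lim_{t\to\infty}\gamma(t)=0$. - $\mathcal{KL}$: functions $\beta:\mathbb{R}_+\times\mathbb{R}_+\to\mathbb{R}_+$ with $\beta(\cdot,t)\in\mathcal{K}$ for all $t\ge0$ and $\beta(r,\cdot)\in\mathcal{L}$ for all $r>0$. Impulsive system: $T=\{t_1,t_2,t_3,\dots\}$ is a monotonically increasing sequence of impulse times without finite accumulation points. Admissible inputs are functions $u\in L_\infty([t_0,\infty),\mathbb{R}^m)$ that are right-continuous and possess left limits $u^-(t)=\lim_{s\to t-0}u(s)$ at all times; $\|u\|_\infty$ is the supremum norm. Solutions $x:[t_0,\infty)\to\mathbb{R}^n$ start at $x(t_0)=x_0$, are absolutely continuous between impulses, are right-continuous, and have left limits $x^-(t)=\lim_{s\to t-0}x(s)$. The local Lipschitz assumption on $f$ is made in order to guarantee existence and uniqueness of solutions. ISS: for a given sequence $T$, the system is input-to-state stable (ISS) if there exist $\beta\in\mathcal{KL}$ and $\gamma\in\mathcal{K}_\infty$ such that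 for all initial conditions $x_0$, all admissible inputs $u$ and all $t\ge t_0$, $$|x(t)|\le\max\{\beta(|x_0|,t-t_0),\gamma(\|u\|_\infty)\}.$$ ISS-Lyapunov function: a smooth function $V:\mathbb{R}^n\to\mathbb{R}_+$ is an ISS-Lyapunov function for the system if there exist $\psi_1,\psi_2\in\mathcal{K}_\infty$ with $\psi_1(|x|)\le V(x)\le\psi_2(|x|)$ for all $x\in\mathbb{R}^n$, and there exist $\chi\in\mathcal{K}_\infty$, $\alpha\in\mathcal{P}$ and a continuous function $\varphi:\mathbb{R}_+\to\mathbb{R}$ with $\varphi(0)=0$ such that for all $x\in\mathbb{R}^n$, $u\in\mathbb{R}^m$: if $V(x)\ge\chi(|u|)$, then both $\dot V(x)=\nabla V(x)\cdot f(x,u)\le-\varphi(V(x))$ and $V(g(x,u))\le\alpha(V(x))$.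
   Formalization: The jump map g is additionally assumed to be continuous at (0,0) and to map bounded sets to bounded sets; for arbitrary g the claim fails, since jumps from states with V(x)<χ(|u|) are otherwise unconstrained. *)

theory Defs
  imports "HOL-Analysis.Analysis"
begin

text \<open>
  Functions on the half-line of nonnegative reals are represented by functions on \<open>real\<close>
  of which only the values on \<open>{0..}\<close> matter.  In the classes below nonnegativity of the
  values is a consequence of the other conditions wherever it is not stated.
\<close>

definition class_P :: "(real \<Rightarrow> real) \<Rightarrow> bool" where
  "class_P \<gamma> \<longleftrightarrow> continuous_on {0..} \<gamma> \<and> \<gamma> 0 = 0 \<and> (\<forall>r>0. \<gamma> r > 0)"

definition class_K :: "(real \<Rightarrow> real) \<Rightarrow> bool" where
  "class_K \<gamma> \<longleftrightarrow> class_P \<gamma> \<and> strict_mono_on {0..} \<gamma>"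

definition class_Kinf :: "(real \<Rightarrow> real) \<Rightarrow> bool" where
  "class_Kinf \<gamma> \<longleftrightarrow> class_K \<gamma> \<and> \<not> bounded (\<gamma> ` {0..})"

definition class_L :: "(real \<Rightarrow> real) \<Rightarrow> bool" where
  "class_L \<gamma> \<longleftrightarrow> continuous_on {0..} \<gamma> \<and> (\<forall>t\<ge>0. \<gamma> t \<ge> 0) \<and>
     strict_antimono_on {0..} \<gamma> \<and> (\<gamma> \<longlongrightarrow> 0) at_top"

definition class_KL :: "(real \<Rightarrow> real \<Rightarrow> real) \<Rightarrow> bool" where
  "class_KL \<beta> \<longleftrightarrow> (\<forall>t\<ge>0. class_K (\<lambda>r. \<beta> r t)) \<and> (\<forall>r>0. class_L (\<beta> r))"

definition partial_deriv :: "'n::finite \<Rightarrow> (real^'n \<Rightarrow> real) \<Rightarrow> real^'n \<Rightarrow> real" where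
  "partial_deriv i h x = frechet_derivative h (at x) (axis i 1)"

definition grad :: "(real^'n \<Rightarrow> real) \<Rightarrow> real^'n \<Rightarrow> real^'n" where
  "grad h x = (\<chi> i. partial_deriv i h x)"

primrec C_diff :: "nat \<Rightarrow> (real^'n \<Rightarrow> real) \<Rightarrow> bool" where
  "C_diff 0 h \<longleftrightarrow> continuous_on UNIV h"
| "C_diff (Suc k) h \<longleftrightarrow> (\<forall>x. h differentiable (at x)) \<and> (\<forall>i. C_diff k (partial_deriv i h))"

definition smooth :: "(real^'n \<Rightarrow> real) \<Rightarrow> bool" where
  "smooth h \<longleftrightarrow> (\<forall>k. C_diff k h)"

text \<open>
  The family \<open>D\<close> consists of finitely many nonoverlapping compact subintervals
  \<open>{Inf K..Sup K}\<close> of \<open>{a..b}\<close>.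
\<close>

definition absolutely_continuous_on_Icc ::
  "real \<Rightarrow> real \<Rightarrow> (real \<Rightarrow> 'a::real_normed_vector) \<Rightarrow> bool" where
  "absolutely_continuous_on_Icc a b h \<longleftrightarrow>
     (\<forall>\<epsilon>>0. \<exists>\<delta>>0. \<forall>D. D division_of \<Union>D \<and> \<Union>D \<subseteq> {a..b} \<and> (\<Sum>K\<in>D. Sup K - Inf K) < \<delta> \<longrightarrow>
        (\<Sum>K\<in>D. norm (h (Sup K) - h (Inf K))) < \<epsilon>)"

definition left_limit :: "(real \<Rightarrow> 'a::t2_space) \<Rightarrow> real \<Rightarrow> 'a" where
  "left_limit h t = Lim (at_left t) h"

definition right_continuous_with_left_limits :: "real \<Rightarrow> (real \<Rightarrow> 'a::t2_space) \<Rightarrow> bool" where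
  "right_continuous_with_left_limits t0 h \<longleftrightarrow>
     (\<forall>t\<ge>t0. continuous (at_right t) h) \<and> (\<forall>t>t0. \<exists>l. (h \<longlongrightarrow> l) (at_left t))"

definition admissible_input :: "real \<Rightarrow> (real \<Rightarrow> real^'m) \<Rightarrow> bool" where
  "admissible_input t0 u \<longleftrightarrow>
     set_borel_measurable lborel {t0..} u \<and> bounded (u ` {t0..}) \<and>
     right_continuous_with_left_limits t0 u"

definition sup_norm :: "real \<Rightarrow> (real \<Rightarrow> real^'m) \<Rightarrow> real" where
  "sup_norm t0 u = (SUP t\<in>{t0..}. norm (u t))"

text \<open>Sequences are indexed from 0, so \<open>\<tau> 0\<close> is the first impulse time.\<close>

definition impulse_time_sequence :: "real \<Rightarrow> real set \<Rightarrow> bool" where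
  "impulse_time_sequence t0 T \<longleftrightarrow>
     (\<exists>\<tau>::nat \<Rightarrow> real. T = range \<tau> \<and> (\<forall>i. t0 \<le> \<tau> i) \<and> strict_mono \<tau>) \<and>
     (\<forall>s. \<not> s islimpt T)"

definition dwell_time_sequences :: "real \<Rightarrow> real \<Rightarrow> real set set" where
  "dwell_time_sequences t0 \<theta> =
     {range \<tau> | \<tau> :: nat \<Rightarrow> real. (\<forall>i. t0 \<le> \<tau> i) \<and> (\<forall>i. \<tau> (Suc i) - \<tau> i \<ge> \<theta>)}"

text \<open>
  Solutions are Caratheodory solutions: locally absolutely continuous between impulses (the
  left end of the interval \<open>{a..b}\<close> below may be an impulse time) and satisfying the
  differential equation almost everywhere.  An impulse at the initial time itself has no
  effect: there is no left limit at \<open>t0\<close>, and the value there is the initial condition.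
\<close>

definition is_solution ::
  "real \<Rightarrow> ((real^'n) \<times> (real^'m) \<Rightarrow> real^'n) \<Rightarrow> ((real^'n) \<times> (real^'m) \<Rightarrow> real^'n) \<Rightarrow>
   real set \<Rightarrow> (real \<Rightarrow> real^'m) \<Rightarrow> real^'n \<Rightarrow> (real \<Rightarrow> real^'n) \<Rightarrow> bool" where
  "is_solution t0 f g T u x0 x \<longleftrightarrow>
     x t0 = x0 \<and>
     right_continuous_with_left_limits t0 x \<and>
     (\<forall>a b. t0 \<le> a \<and> a \<le> b \<and> {a<..b} \<inter> T = {} \<longrightarrow> absolutely_continuous_on_Icc a b x) \<and>
     (AE t in lebesgue. t \<in> {t0..} - T \<longrightarrow> (x has_vector_derivative f (x t, u t)) (at t)) \<and>
     (\<forall>t\<in>T. t > t0 \<longrightarrow> x t = g (left_limit x t, left_limit u t))"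

definition input_to_state_stable ::
  "real \<Rightarrow> ((real^'n) \<times> (real^'m) \<Rightarrow> real^'n) \<Rightarrow> ((real^'n) \<times> (real^'m) \<Rightarrow> real^'n) \<Rightarrow>
   real set \<Rightarrow> bool" where
  "input_to_state_stable t0 f g T \<longleftrightarrow>
     (\<exists>\<beta> \<gamma>. class_KL \<beta> \<and> class_Kinf \<gamma> \<and>
        (\<forall>x0 u x. admissible_input t0 u \<and> is_solution t0 f g T u x0 x \<longrightarrow>
           (\<forall>t\<ge>t0. norm (x t) \<le> max (\<beta> (norm x0) (t - t0)) (\<gamma> (sup_norm t0 u)))))"

text \<open>\<open>V\<close> is an ISS-Lyapunov function, with associated functions \<open>\<phi>\<close> and \<open>\<alpha>\<close>.\<close>

definition ISS_Lyapunov_function ::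
  "((real^'n) \<times> (real^'m) \<Rightarrow> real^'n) \<Rightarrow> ((real^'n) \<times> (real^'m) \<Rightarrow> real^'n) \<Rightarrow>
   (real^'n \<Rightarrow> real) \<Rightarrow> (real \<Rightarrow> real) \<Rightarrow> (real \<Rightarrow> real) \<Rightarrow> bool" where
  "ISS_Lyapunov_function f g V \<phi> \<alpha> \<longleftrightarrow>
     smooth V \<and> (\<forall>x. 0 \<le> V x) \<and>
     (\<exists>\<psi>1 \<psi>2. class_Kinf \<psi>1 \<and> class_Kinf \<psi>2 \<and>
        (\<forall>x. \<psi>1 (norm x) \<le> V x \<and> V x \<le> \<psi>2 (norm x))) \<and>
     continuous_on {0..} \<phi> \<and> \<phi> 0 = 0 \<and> class_P \<alpha> \<and>
     (\<exists>chi. class_Kinf chi \<and>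
        (\<forall>x u. V x \<ge> chi (norm u) \<longrightarrow>
           grad V x \<bullet> f (x, u) \<le> - \<phi> (V x) \<and> V (g (x, u)) \<le> \<alpha> (V x)))"

end

theory Submission
  imports Defs
begin

text \<open>
  Let \<open>F\<close> be an antiderivative of \<open>1 / \<phi>\<close> on \<open>{0<..}\<close> and \<open>c\<close> the level of \<open>V\<close> below which the
  Lyapunov inequalities give no information for the input at hand.  While \<open>V (x t) > c\<close>, the
  function \<open>F (V (x t))\<close> decreases with speed at least 1 between impulses, and by the dwell-time
  condition it grows by at most \<open>\<theta> - \<delta>\<close> at each of them.  Since impulses are at least \<open>\<theta>\<close> apart,
  the net decrease after the first impulse is at least \<open>\<delta> / \<theta>\<close> per unit of time.  From below
  \<open>c\<close> the solution can only jump to a level controlled by the input, through the local boundedness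
  of \<open>g\<close> and its continuity at 0, and then it does not exceed this level any more.

  The range of \<open>F\<close> may be bounded above, so \<open>F (V (x0)) + \<theta> - \<delta>\<close> may be outside it.  This is why the
  first impulse is estimated by \<open>\<alpha>\<close> itself.  The bound then depends on the time of the first impulse,
  which is harmless as the impulse times are fixed.
\<close>

subsection \<open>Absolutely continuous functions\<close>

text \<open>A straddle estimate: with the tag \<open>x\<close> between \<open>u\<close> and
  \<open>v\<close>, the increments on the two sides of \<open>x\<close> are compared with the
  tangent separately, and the errors add up to at most \<open>e * (v - u)\<close>.\<close>

lemma has_vector_derivative_fine_upper_bound:
  fixes h :: "real \<Rightarrow> real"
  assumes "(h has_vector_derivative D) (at x)" "e > 0"
  obtains d where "d > 0"
    "\<And>u v. u \<le> x \<Longrightarrow> x \<le> v \<Longrightarrow> {u..v} \<subseteq> ball x d \<Longrightarrow> h v - h u \<le> (D + e) * (v - u)"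
proof -
  from assms obtain d where d: "d > 0"
    and *: "\<And>y. norm (y - x) < d \<Longrightarrow> norm (h y - h x - (y - x) * D) \<le> e * norm (y - x)"
    unfolding has_vector_derivative_def has_derivative_at_alt by (auto simp: real_scaleR_def)
  show ?thesis
  proof (rule that[OF d])
    fix u v assume uv: "u \<le> x" "x \<le> v" "{u..v} \<subseteq> ball x d"
    then have "u \<in> ball x d" "v \<in> ball x d" using atLeastAtMost_iff by (meson order.trans order.refl subsetD)+
    then have "norm (u - x) < d" "norm (v - x) < d" by (auto simp: dist_norm norm_minus_commute)
    from *[OF this(1)] *[OF this(2)] uv
    have "h v - h x \<le> (D + e) * (v - x)" "h x - h u \<le> (D + e) * (x - u)"
      by (auto simp: algebra_simps abs_if split: if_splits)
    then show "h v - h u \<le> (D + e) * (v - u)" by (auto simp: algebra_simps)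
  qed
qed

text \<open>Only degenerate intervals can occur under several tags, and their increments vanish, so
  forgetting the tags does not change the sum. This links gauges with absolute continuity, which is
  stated for untagged divisions.\<close>

lemma sum_tagged_partial_division_increments:
  fixes h :: "real \<Rightarrow> 'a::real_normed_vector"
  assumes "p tagged_partial_division_of S"
  shows "(\<Sum>(x, K)\<in>p. h (Sup K) - h (Inf K)) = (\<Sum>K\<in>snd ` p. h (Sup K) - h (Inf K))"
proof -
  \<comment> \<open>The value 0 is required on every box with empty interior, including the empty
    set, where \<open>Sup\<close> and \<open>Inf\<close> carry no information.\<close>
  let ?d = "\<lambda>K. if K = {} then 0 else h (Sup K) - h (Inf K)"
  have ne: "K \<noteq> {}" if "(x, K) \<in> p" for x K
    using assms that unfolding tagged_partial_division_of_def by blast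
  have "(\<Sum>(x, K)\<in>p. h (Sup K) - h (Inf K)) = (\<Sum>(x, K)\<in>p. ?d K)"
    using ne by (intro sum.cong) auto
  also have "\<dots> = sum ?d (snd ` p)"
  proof (rule sum.over_tagged_division_lemma[OF tagged_partial_division_of_Union_self[OF assms]])
    fix u v :: real assume "box u v = {}"
    then have "cbox u v = {} \<or> u = v" by auto
    then show "?d (cbox u v) = 0" by auto
  qed
  also have "\<dots> = (\<Sum>K\<in>snd ` p. h (Sup K) - h (Inf K))"
    using ne by (intro sum.cong) auto
  finally show ?thesis .
qed

text \<open>The total length is the measure of the union. It becomes small for intervals tagged in a
  null set, once these lie in an open cover \<open>U\<close> of small measure.\<close>

lemma sum_length_division_le_measure:
  fixes D :: "real set set"
  assumes D: "D division_of \<Union>D" and U: "U \<in> lmeasurable" "\<Union>D \<subseteq> U"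
  shows "0 \<le> (\<Sum>K\<in>D. Sup K - Inf K)" "(\<Sum>K\<in>D. Sup K - Inf K) \<le> measure lebesgue U"
proof -
  have len: "Sup K - Inf K = measure lebesgue K" if K: "K \<in> D" for K
  proof -
    from division_ofD(3,4)[OF D K] obtain u v where "K = {u..v}" "u \<le> v" by fastforce
    then show ?thesis by simp
  qed
  then have eq: "(\<Sum>K\<in>D. Sup K - Inf K) = measure lebesgue (\<Union>D)"
    using content_division[OF D] by simp
  show "0 \<le> (\<Sum>K\<in>D. Sup K - Inf K)" by (simp add: eq)
  show "(\<Sum>K\<in>D. Sup K - Inf K) \<le> measure lebesgue U"
    unfolding eq
    by (rule measure_mono_fmeasurable) (use U lmeasurable_division[OF D] in \<open>auto simp: fmeasurable_def\<close>)
qed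

lemma absolutely_continuous_on_IccE:
  fixes h :: "real \<Rightarrow> 'a::real_normed_vector"
  assumes "absolutely_continuous_on_Icc a b h" "e > 0"
  obtains d where "d > 0"
    "\<And>D. D division_of \<Union>D \<Longrightarrow> \<Union>D \<subseteq> {a..b} \<Longrightarrow> (\<Sum>K\<in>D. Sup K - Inf K) < d
      \<Longrightarrow> (\<Sum>K\<in>D. norm (h (Sup K) - h (Inf K))) < e"
proof -
  from assms obtain d where d: "d > 0" and *: "\<forall>D. D division_of \<Union>D \<and> \<Union>D \<subseteq> {a..b} \<and>
      (\<Sum>K\<in>D. Sup K - Inf K) < d \<longrightarrow> (\<Sum>K\<in>D. norm (h (Sup K) - h (Inf K))) < e"
    unfolding absolutely_continuous_on_Icc_def by blast
  show ?thesis by (rule that[OF d]) (use * in blast)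
qed

text \<open>
  In a fine tagged division the intervals with tags in the exceptional null set have small total
  length, so absolute continuity controls their contribution.
\<close>
lemma absolutely_continuous_on_Icc_increment_le:
  fixes h :: "real \<Rightarrow> real"
  assumes ac: "absolutely_continuous_on_Icc a b h" and ab: "a \<le> b" and N: "negligible N"
    and deriv: "\<And>t. t \<in> {a..b} - N \<Longrightarrow> \<exists>D\<le>M. (h has_vector_derivative D) (at t)"
  shows "h b - h a \<le> M * (b - a)"
proof -
  have bound: "h b - h a \<le> (M + e) * (b - a) + e + \<bar>M + e\<bar> * e" if e: "e > 0" for e
  proof -
    obtain d where d: "d > 0"
      and small: "\<And>D. D division_of \<Union>D \<Longrightarrow> \<Union>D \<subseteq> {a..b} \<Longrightarrow> (\<Sum>K\<in>D. Sup K - Inf K) < d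
        \<Longrightarrow> (\<Sum>K\<in>D. norm (h (Sup K) - h (Inf K))) < e"
      by (rule absolutely_continuous_on_IccE[OF ac e]) (rule that; blast)
    \<comment> \<open>The measure of \<open>U\<close> has to be below \<open>d\<close> to invoke
      absolute continuity and below \<open>e\<close> to control the length removed from
      \<open>b - a\<close>.\<close>
    have "min d e / 2 > 0" using d e by simp
    then obtain U where U: "open U" "N \<subseteq> U" "U \<in> lmeasurable" and Um: "measure lebesgue U < min d e"
    proof -
      have Ns: "N \<in> null_sets lebesgue" using N negligible_iff_null_sets by blast
      obtain U where U: "open U" "N \<subseteq> U" "U - N \<in> lmeasurable"
        "emeasure lebesgue (U - N) < ennreal (min d e / 2)"
        using sets_lebesgue_outer_open[OF _ \<open>min d e / 2 > 0\<close>] Ns by blast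
      have "emeasure lebesgue (U - N) = emeasure lebesgue U"
        using emeasure_Diff_null_set[OF Ns] U(1) by (simp add: borel_open)
      with U(4) have "emeasure lebesgue U < ennreal (min d e / 2)" by simp
      moreover from this have "measure lebesgue U \<le> min d e / 2"
        unfolding measure_def using \<open>min d e / 2 > 0\<close> by (intro enn2real_leI) auto
      moreover have "U \<in> lmeasurable"
        using calculation(1) U(1) by (auto simp: fmeasurable_def borel_open intro: order.strict_trans)
      ultimately show ?thesis using that U(1,2) \<open>min d e / 2 > 0\<close> by force
    qed
    \<comment> \<open>Tags in \<open>N\<close> get balls inside the cover \<open>U\<close>, the
      other points of \<open>{a..b}\<close> get balls on which the straddle estimate holds.
      Elsewhere any radius will do.\<close>
    have "\<exists>r>0. (x \<in> N \<longrightarrow> ball x r \<subseteq> U) \<and> (x \<in> {a..b} - N \<longrightarrow>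
        (\<forall>u v. u \<le> x \<longrightarrow> x \<le> v \<longrightarrow> {u..v} \<subseteq> ball x r \<longrightarrow> h v - h u \<le> (M + e) * (v - u)))" for x
    proof (cases "x \<in> N")
      case True
      then show ?thesis using U(1,2) open_contains_ball by (metis DiffD2 subsetD)
    next
      case nN: False
      show ?thesis
      proof (cases "x \<in> {a..b}")
        case True
        with deriv nN obtain D where D: "D \<le> M" "(h has_vector_derivative D) (at x)" by blast
        obtain r where r: "r > 0"
          "\<And>u v. u \<le> x \<Longrightarrow> x \<le> v \<Longrightarrow> {u..v} \<subseteq> ball x r \<Longrightarrow> h v - h u \<le> (D + e) * (v - u)"
          using has_vector_derivative_fine_upper_bound[OF D(2) e] by blast
        have "h v - h u \<le> (M + e) * (v - u)" if "u \<le> x" "x \<le> v" "{u..v} \<subseteq> ball x r" for u v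
        proof -
          have "(D + e) * (v - u) \<le> (M + e) * (v - u)"
            using D(1) that by (intro mult_right_mono) auto
          then show ?thesis using r(2)[OF that] by linarith
        qed
        then show ?thesis using r(1) nN by blast
      next
        case False
        then show ?thesis using nN by (auto intro: exI[of _ 1])
      qed
    qed
    then obtain R where R: "\<And>x. R x > 0" "\<And>x. x \<in> N \<Longrightarrow> ball x (R x) \<subseteq> U"
      and Rg: "\<And>x u v. x \<in> {a..b} - N \<Longrightarrow> u \<le> x \<Longrightarrow> x \<le> v \<Longrightarrow> {u..v} \<subseteq> ball x (R x)
         \<Longrightarrow> h v - h u \<le> (M + e) * (v - u)"
      by metis
    have "gauge (\<lambda>x. ball x (R x))" using R(1) by (auto simp: gauge_def)
    then obtain p where p: "p tagged_division_of {a..b}" and fine: "(\<lambda>x. ball x (R x)) fine p"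
      using fine_division_exists_real by blast
    define q where "q = {xK \<in> p. fst xK \<in> N}"
    have finp: "finite p" using p by (rule tagged_division_of_finite)
    have pq: "q \<subseteq> p" unfolding q_def by blast
    have q: "q tagged_partial_division_of {a..b}"
      using p by (intro tagged_partial_division_subset[OF _ pq]) (simp add: tagged_division_of_def)
    have D: "snd ` q division_of \<Union>(snd ` q)"
      by (rule division_of_tagged_division[OF tagged_partial_division_of_Union_self[OF q]])
    have Uq: "\<Union>(snd ` q) \<subseteq> U"
      using fineD[OF fine] R(2) unfolding q_def by force
    have Dab: "\<Union>(snd ` q) \<subseteq> {a..b}"
      using tagged_partial_division_ofD(3)[OF q] by force
    have len: "0 \<le> (\<Sum>(x, K)\<in>q. Sup K - Inf K)" "(\<Sum>(x, K)\<in>q. Sup K - Inf K) < min d e"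
      using sum_length_division_le_measure[OF D U(3) Uq] Um
        sum_tagged_partial_division_increments[OF q, of "\<lambda>x. x"] by auto
    have "(\<Sum>(x, K)\<in>q. h (Sup K) - h (Inf K)) = (\<Sum>K\<in>snd ` q. h (Sup K) - h (Inf K))"
      by (rule sum_tagged_partial_division_increments[OF q])
    also have "\<dots> \<le> (\<Sum>K\<in>snd ` q. norm (h (Sup K) - h (Inf K)))" by (intro sum_mono) simp
    also have "\<dots> < e"
      using small[OF D Dab] len sum_tagged_partial_division_increments[OF q, of "\<lambda>x. x"] by auto
    finally have bad: "(\<Sum>(x, K)\<in>q. h (Sup K) - h (Inf K)) \<le> e" by simp
    have "(\<Sum>(x, K)\<in>p - q. h (Sup K) - h (Inf K)) \<le> (\<Sum>(x, K)\<in>p - q. (M + e) * (Sup K - Inf K))"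
    proof (rule sum_mono, clarify)
      fix x K assume xK: "(x, K) \<in> p" "(x, K) \<notin> q"
      from tagged_division_ofD(2,3,4)[OF p xK(1)] obtain u v where uv: "K = {u..v}" "x \<in> K" "K \<subseteq> {a..b}"
        by auto
      moreover have "K \<subseteq> ball x (R x)" using fine xK(1) unfolding fine_def by blast
      ultimately show "h (Sup K) - h (Inf K) \<le> (M + e) * (Sup K - Inf K)"
        using Rg[of x u v] xK by (auto simp: q_def)
    qed
    also have "\<dots> = (M + e) * (\<Sum>(x, K)\<in>p - q. Sup K - Inf K)"
      by (simp add: sum_distrib_left case_prod_unfold)
    also have "(\<Sum>(x, K)\<in>p - q. Sup K - Inf K) = (b - a) - (\<Sum>(x, K)\<in>q. Sup K - Inf K)"
      using additive_tagged_division_1[OF ab p, of "\<lambda>x. x"]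
        sum.subset_diff[OF pq finp, of "\<lambda>(x, K). Sup K - Inf K"] by simp
    finally have good: "(\<Sum>(x, K)\<in>p - q. h (Sup K) - h (Inf K))
        \<le> (M + e) * (b - a) - (M + e) * (\<Sum>(x, K)\<in>q. Sup K - Inf K)"
      by (simp add: algebra_simps)
    \<comment> \<open>\<open>M + e\<close> may be negative, and then removing the intervals tagged
      in \<open>N\<close> from the length \<open>b - a\<close> raises the bound; this excess is at
      most \<open>e\<close> times the absolute value of \<open>M + e\<close>.\<close>
    have "- (M + e) * (\<Sum>(x, K)\<in>q. Sup K - Inf K) \<le> \<bar>M + e\<bar> * (\<Sum>(x, K)\<in>q. Sup K - Inf K)"
      using len(1) by (intro mult_right_mono) auto
    also have "\<dots> \<le> \<bar>M + e\<bar> * e" using len by (intro mult_left_mono) auto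
    finally have "- (M + e) * (\<Sum>(x, K)\<in>q. Sup K - Inf K) \<le> \<bar>M + e\<bar> * e" .
    moreover have "h b - h a = (\<Sum>(x, K)\<in>p - q. h (Sup K) - h (Inf K)) + (\<Sum>(x, K)\<in>q. h (Sup K) - h (Inf K))"
      using additive_tagged_division_1[OF ab p, of h]
        sum.subset_diff[OF pq finp, of "\<lambda>(x, K). h (Sup K) - h (Inf K)"] by simp
    ultimately show ?thesis using good bad unfolding mult_minus_left by linarith
  qed
  have "((\<lambda>e. (M + e) * (b - a) + e + \<bar>M + e\<bar> * e) \<longlongrightarrow> (M + 0) * (b - a) + 0 + \<bar>M + 0\<bar> * 0) (at_right 0)"
    by (intro tendsto_intros)
  moreover have "\<forall>\<^sub>F e in at_right 0. h b - h a \<le> (M + e) * (b - a) + e + \<bar>M + e\<bar> * e"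
    using bound by (auto simp: eventually_at_right_field intro: exI[of _ 1])
  ultimately have "h b - h a \<le> (M + 0) * (b - a) + 0 + \<bar>M + 0\<bar> * 0"
    by (intro tendsto_lowerbound[of _ _ "at_right 0"]) auto
  then show ?thesis by simp
qed

lemma absolutely_continuous_on_Icc_imp_continuous_on:
  fixes h :: "real \<Rightarrow> 'a::real_normed_vector"
  assumes "absolutely_continuous_on_Icc a b h"
  shows "continuous_on {a..b} h"
  unfolding continuous_on_iff
proof (intro ballI allI impI)
  fix s e :: real assume s: "s \<in> {a..b}" and e: "e > 0"
  obtain d where d: "d > 0"
    and small: "\<And>D. D division_of \<Union>D \<Longrightarrow> \<Union>D \<subseteq> {a..b} \<Longrightarrow> (\<Sum>K\<in>D. Sup K - Inf K) < d
        \<Longrightarrow> (\<Sum>K\<in>D. norm (h (Sup K) - h (Inf K))) < e"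
    by (rule absolutely_continuous_on_IccE[OF assms e]) (rule that; blast)
  have "norm (h v - h u) < e" if "u \<in> {a..b}" "v \<in> {a..b}" "u \<le> v" "v - u < d" for u v
  proof -
    have "{{u..v}} division_of \<Union>{{u..v}}"
      using division_of_self[of u v] that by auto
    from small[OF this] show ?thesis using that by auto
  qed
  then have "dist (h t) (h s) < e" if "t \<in> {a..b}" "dist t s < d" for t
    using that s by (cases "t \<le> s") (auto simp: dist_norm, metis norm_minus_commute)
  then show "\<exists>d>0. \<forall>t\<in>{a..b}. dist t s < d \<longrightarrow> dist (h t) (h s) < e" using d by blast
qed

text \<open>Applied twice along a solution, first to \<open>V\<close> and then to \<open>F\<close>,
  each being Lipschitz on the compact set of values that it meets there.\<close>

lemma absolutely_continuous_on_Icc_lipschitz_compose: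
  fixes h :: "real \<Rightarrow> 'a::real_normed_vector" and q :: "'a \<Rightarrow> 'b::real_normed_vector"
  assumes ac: "absolutely_continuous_on_Icc a b h" and lip: "L-lipschitz_on (h ` {a..b}) q"
  shows "absolutely_continuous_on_Icc a b (\<lambda>t. q (h t))"
  unfolding absolutely_continuous_on_Icc_def
proof (intro allI impI)
  fix e :: real assume e: "e > 0"
  have L: "L \<ge> 0" using lip lipschitz_on_nonneg by blast
  \<comment> \<open>\<open>L + 1\<close> in place of \<open>L\<close> covers the case
    \<open>L = 0\<close> and makes the final inequality strict.\<close>
  with e have e': "e / (L + 1) > 0" by simp
  obtain d where d: "d > 0"
    and small: "\<And>D. D division_of \<Union>D \<Longrightarrow> \<Union>D \<subseteq> {a..b} \<Longrightarrow> (\<Sum>K\<in>D. Sup K - Inf K) < d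
        \<Longrightarrow> (\<Sum>K\<in>D. norm (h (Sup K) - h (Inf K))) < e / (L + 1)"
    by (rule absolutely_continuous_on_IccE[OF ac e']) (rule that; blast)
  have "(\<Sum>K\<in>D. norm (q (h (Sup K)) - q (h (Inf K)))) < e"
    if D: "D division_of \<Union>D" and Dab: "\<Union>D \<subseteq> {a..b}" and sD: "(\<Sum>K\<in>D. Sup K - Inf K) < d" for D
  proof -
    have "(\<Sum>K\<in>D. norm (q (h (Sup K)) - q (h (Inf K)))) \<le> (\<Sum>K\<in>D. L * norm (h (Sup K) - h (Inf K)))"
    proof (rule sum_mono)
      fix K assume K: "K \<in> D"
      from division_ofD(3,4)[OF D K] obtain u v where "K = {u..v}" "u \<le> v" by fastforce
      moreover from this have "u \<in> {a..b}" "v \<in> {a..b}" using K Dab by fastforce+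
      ultimately show "norm (q (h (Sup K)) - q (h (Inf K))) \<le> L * norm (h (Sup K) - h (Inf K))"
        using lipschitz_on_normD[OF lip] by simp
    qed
    also have "\<dots> = L * (\<Sum>K\<in>D. norm (h (Sup K) - h (Inf K)))" by (simp add: sum_distrib_left)
    also have "\<dots> \<le> L * (e / (L + 1))"
      using small[OF D Dab sD] L by (intro mult_left_mono) auto
    also have "\<dots> < e" using L e by (simp add: field_simps)
    finally show ?thesis .
  qed
  with d show "\<exists>d>0. \<forall>D. D division_of \<Union>D \<and> \<Union>D \<subseteq> {a..b} \<and> (\<Sum>K\<in>D. Sup K - Inf K) < d \<longrightarrow>
      (\<Sum>K\<in>D. norm (q (h (Sup K)) - q (h (Inf K)))) < e"
    by blast
qed

subsection \<open>Comparison functions\<close>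

text \<open>Strict monotonicity and the value 0 at 0 force positivity for positive arguments, so an
  unbounded image is one that is unbounded above.\<close>

lemma class_Kinf_iff:
  "class_Kinf \<gamma> \<longleftrightarrow>
    continuous_on {0..} \<gamma> \<and> \<gamma> 0 = 0 \<and> strict_mono_on {0..} \<gamma> \<and> (\<forall>M. \<exists>r\<ge>0. M < \<gamma> r)"
    (is "?L \<longleftrightarrow> ?R")
proof -
  have pos: "0 < \<gamma> r" if "\<gamma> 0 = 0" "strict_mono_on {0..} \<gamma>" "r > 0" for r
    using that strict_mono_onD[of "{0..}" \<gamma> 0 r] by simp
  have bdd: "bounded (\<gamma> ` {0..}) \<longleftrightarrow> (\<exists>M. \<forall>r\<ge>0. \<gamma> r \<le> M)"
    if "\<gamma> 0 = 0" "strict_mono_on {0..} \<gamma>"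
  proof
    assume "\<exists>M. \<forall>r\<ge>0. \<gamma> r \<le> M"
    then obtain M where M: "\<And>r. r \<ge> 0 \<Longrightarrow> \<gamma> r \<le> M" by blast
    have "norm (\<gamma> r) \<le> M" if "r \<ge> 0" for r
      using M[OF that] pos[OF \<open>\<gamma> 0 = 0\<close> \<open>strict_mono_on {0..} \<gamma>\<close>, of r] that \<open>\<gamma> 0 = 0\<close>
      by (cases "r = 0") auto
    then show "bounded (\<gamma> ` {0..})" by (auto simp: bounded_iff)
  next
    assume "bounded (\<gamma> ` {0..})"
    then obtain B where "\<And>r. r \<ge> 0 \<Longrightarrow> norm (\<gamma> r) \<le> B" by (auto simp: bounded_iff)
    then have "\<forall>r\<ge>0. \<gamma> r \<le> B" using norm_ge_zero abs_le_D1 by (metis real_norm_def)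
    then show "\<exists>M. \<forall>r\<ge>0. \<gamma> r \<le> M" by blast
  qed
  have "\<not> (\<exists>M. \<forall>r\<ge>0. \<gamma> r \<le> M) \<longleftrightarrow> (\<forall>M. \<exists>r\<ge>0. M < \<gamma> r)" by (auto simp: not_le)
  with pos bdd show ?thesis
    unfolding class_Kinf_def class_K_def class_P_def by blast
qed

lemma class_Kinf_less_iff:
  assumes "class_Kinf \<gamma>" "0 \<le> r" "0 \<le> s"
  shows "\<gamma> r < \<gamma> s \<longleftrightarrow> r < s"
  using assms by (auto simp: class_Kinf_iff strict_mono_on_less)

lemma class_Kinf_le_iff:
  assumes "class_Kinf \<gamma>" "0 \<le> r" "0 \<le> s"
  shows "\<gamma> r \<le> \<gamma> s \<longleftrightarrow> r \<le> s"
  using assms by (auto simp: class_Kinf_iff strict_mono_on_less_eq)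

lemma class_Kinf_zero: "class_Kinf \<gamma> \<Longrightarrow> \<gamma> 0 = 0"
  by (simp add: class_Kinf_iff)

lemma class_Kinf_nonneg: "class_Kinf \<gamma> \<Longrightarrow> 0 \<le> r \<Longrightarrow> 0 \<le> \<gamma> r"
  using class_Kinf_le_iff[of \<gamma> 0 r] class_Kinf_zero[of \<gamma>] by simp

lemma class_Kinf_continuous: "class_Kinf \<gamma> \<Longrightarrow> continuous_on {0..} \<gamma>"
  by (simp add: class_Kinf_iff)

lemma class_Kinf_compose:
  assumes \<gamma>: "class_Kinf \<gamma>" and \<eta>: "class_Kinf \<eta>"
  shows "class_Kinf (\<lambda>r. \<gamma> (\<eta> r))"
  unfolding class_Kinf_iff
proof (intro conjI allI)
  show "continuous_on {0..} (\<lambda>r. \<gamma> (\<eta> r))"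
    by (rule continuous_on_compose2[OF class_Kinf_continuous[OF \<gamma>] class_Kinf_continuous[OF \<eta>]])
       (use class_Kinf_nonneg[OF \<eta>] in auto)
  show "\<gamma> (\<eta> 0) = 0" using \<gamma> \<eta> by (simp add: class_Kinf_zero)
  show "strict_mono_on {0..} (\<lambda>r. \<gamma> (\<eta> r))"
    by (rule strict_mono_onI) (simp add: class_Kinf_less_iff[OF \<gamma>] class_Kinf_less_iff[OF \<eta>] class_Kinf_nonneg[OF \<eta>])
  fix M
  obtain s where s: "s \<ge> 0" "M < \<gamma> s" using \<gamma> class_Kinf_iff by blast
  obtain r where r: "r \<ge> 0" "s < \<eta> r" using \<eta> class_Kinf_iff by blast
  have "\<gamma> s < \<gamma> (\<eta> r)" using class_Kinf_less_iff[OF \<gamma>] s r by auto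
  then show "\<exists>r\<ge>0. M < \<gamma> (\<eta> r)" using s r by (intro exI[of _ r]) auto
qed

text \<open>Strictness and unboundedness come from \<open>\<gamma>\<close> alone, so
  \<open>\<eta>\<close> may have flat pieces, as the averages in the majorant construction below
  can.\<close>

lemma class_Kinf_add_mono:
  assumes \<gamma>: "class_Kinf \<gamma>" and cont: "continuous_on {0..} \<eta>" and zero: "\<eta> 0 = 0"
    and mono: "mono_on {0..} \<eta>"
  shows "class_Kinf (\<lambda>r. \<gamma> r + \<eta> r)"
  unfolding class_Kinf_iff
proof (intro conjI allI)
  show "continuous_on {0..} (\<lambda>r. \<gamma> r + \<eta> r)"
    by (intro continuous_intros class_Kinf_continuous \<gamma> cont)
  show "\<gamma> 0 + \<eta> 0 = 0" using \<gamma> zero by (simp add: class_Kinf_zero)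
  show "strict_mono_on {0..} (\<lambda>r. \<gamma> r + \<eta> r)"
    using mono by (auto intro!: strict_mono_onI add_less_le_mono simp: class_Kinf_less_iff[OF \<gamma>] mono_on_def)
  fix M
  obtain r where r: "r \<ge> 0" "M < \<gamma> r" using \<gamma> class_Kinf_iff by blast
  moreover have "\<eta> 0 \<le> \<eta> r" using mono r(1) by (auto simp: mono_on_def)
  ultimately show "\<exists>r\<ge>0. M < \<gamma> r + \<eta> r" using zero by (intro exI[of _ r]) auto
qed

lemma class_Kinf_add:
  assumes "class_Kinf \<gamma>" "class_Kinf \<eta>"
  shows "class_Kinf (\<lambda>r. \<gamma> r + \<eta> r)"
  using assms by (intro class_Kinf_add_mono)
    (auto simp: class_Kinf_iff strict_mono_on_imp_mono_on)

lemma class_Kinf_id: "class_Kinf (\<lambda>r. r)"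
  unfolding class_Kinf_iff
  by (auto intro!: continuous_intros strict_mono_onI) (metis gt_ex less_le_not_le linorder_le_cases order.strict_trans1)

text \<open>By the intermediate value theorem \<open>\<psi>\<close> maps the half-line onto itself,
  and a continuous injective map of an interval is a homeomorphism onto its image. The inverse of
  the lower bound for \<open>V\<close> will turn bounds on \<open>V\<close> into bounds on the
  norm.\<close>

lemma class_Kinf_inverse:
  assumes \<psi>: "class_Kinf \<psi>"
  obtains \<sigma> where "class_Kinf \<sigma>" "\<And>r. 0 \<le> r \<Longrightarrow> \<sigma> (\<psi> r) = r" "\<And>r. 0 \<le> r \<Longrightarrow> \<psi> (\<sigma> r) = r"
proof -
  have onto: "\<psi> ` {0..} = {0..}"
  proof safe
    fix s :: real assume s: "s \<ge> 0"
    obtain r where r: "r \<ge> 0" "s < \<psi> r" using \<psi> class_Kinf_iff by blast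
    have "continuous_on {0..r} \<psi>"
      using class_Kinf_continuous[OF \<psi>] continuous_on_subset by fastforce
    then obtain q where "q \<ge> 0" "\<psi> q = s"
      using IVT'[of \<psi> 0 s r] class_Kinf_zero[OF \<psi>] s r by auto
    then show "s \<in> \<psi> ` {0..}" by force
  qed (use class_Kinf_nonneg[OF \<psi>] in auto)
  have inj: "inj_on \<psi> {0..}"
    using \<psi> by (auto simp: class_Kinf_iff strict_mono_on_imp_inj_on)
  obtain \<sigma> where \<sigma>: "homeomorphism {0..} {0..} \<psi> \<sigma>"
    using homeomorphism_into_1d[OF _ class_Kinf_continuous[OF \<psi>] onto inj] convex_imp_path_connected by blast
  have inv: "\<sigma> (\<psi> r) = r" "\<psi> (\<sigma> r) = r" "\<sigma> r \<ge> 0" if "r \<ge> 0" for r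
    using \<sigma> that by (auto simp: homeomorphism_def)
  have "class_Kinf \<sigma>"
    unfolding class_Kinf_iff
  proof (intro conjI allI)
    show "continuous_on {0..} \<sigma>" using \<sigma> by (simp add: homeomorphism_def)
    show "\<sigma> 0 = 0" using inv(1)[of 0] class_Kinf_zero[OF \<psi>] by simp
    show "strict_mono_on {0..} \<sigma>"
      using inv class_Kinf_less_iff[OF \<psi>] by (intro strict_mono_onI) (metis atLeast_iff)
    fix M :: real
    have "\<sigma> (\<psi> (\<bar>M\<bar> + 1)) > M" by (simp add: inv(1))
    then show "\<exists>r\<ge>0. M < \<sigma> r" using class_Kinf_nonneg[OF \<psi>, of "\<bar>M\<bar> + 1"] by auto
  qed
  then show ?thesis using that inv by blast
qed

text \<open>The averages \<open>\<integral>\<^sub>1\<^sup>2 M (r s) ds\<close> of the monotone envelope \<open>M\<close> are continuous in \<open>r\<close>.\<close>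
lemma class_Kinf_majorant:
  fixes h size :: "'a \<Rightarrow> real"
  assumes size: "\<And>p. 0 \<le> size p" and bdd: "\<And>R. \<exists>B. \<forall>p. size p \<le> R \<longrightarrow> h p \<le> B"
    and small: "\<And>e. e > 0 \<Longrightarrow> \<exists>d>0. \<forall>p. size p \<le> d \<longrightarrow> h p \<le> e"
  obtains \<gamma> where "class_Kinf \<gamma>" "\<And>p. h p \<le> \<gamma> (size p)"
proof -
  \<comment> \<open>The inserted 0 gives the supremum a meaning when no \<open>p\<close> has size at
    most \<open>r\<close>, and keeps it nonnegative.\<close>
  define M where "M r = Sup (insert 0 (h ` {p. size p \<le> r}))" for r
  have bddA: "bdd_above (insert 0 (h ` {p. size p \<le> r}))" for r
    using bdd[of r] by (auto intro: bdd_aboveI2)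
  have M_mono: "M r \<le> M s" if "r \<le> s" for r s
    unfolding M_def by (rule cSup_subset_mono) (use that bddA in auto)
  have M_ge: "h p \<le> M r" if "size p \<le> r" for p r
    unfolding M_def by (rule cSup_upper) (use that bddA in auto)
  have M_nonneg: "0 \<le> M r" for r
    unfolding M_def by (rule cSup_upper) (use bddA in auto)
  have M_small: "\<exists>d>0. M d \<le> e" if "e > 0" for e
  proof -
    from small[OF that] obtain d where d: "d > 0" "\<And>p. size p \<le> d \<Longrightarrow> h p \<le> e" by blast
    have "M d \<le> e" unfolding M_def by (rule cSup_least) (use d that in auto)
    with d show ?thesis by blast
  qed
  have M_0: "M 0 = 0"
  proof (rule antisym[OF field_le_epsilon M_nonneg])
    fix e :: real assume "e > 0"
    then obtain d where "d > 0" "M d \<le> e" using M_small by blast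
    then show "M 0 \<le> 0 + e" using M_mono[of 0 d] by simp
  qed
  have M_int: "M integrable_on {a..b}" for a b
    by (rule integrable_on_mono_on) (auto intro!: mono_onI M_mono)
  have Ms_int: "(\<lambda>s. M (r * s)) integrable_on {a..b}" if "r \<ge> 0" for a b r
    by (rule integrable_on_mono_on) (auto intro!: mono_onI M_mono mult_left_mono that)
  define A where "A r = integral {1..2} (\<lambda>s. M (r * s))" for r
  \<comment> \<open>For \<open>s\<close> in \<open>{1..2}\<close> the argument \<open>r * s\<close>
    lies between \<open>r\<close> and \<open>2 * r\<close>. The lower bound gives the domination of
    \<open>h\<close>, the upper one the continuity of \<open>A\<close> at 0.\<close>
  have A_bounds: "M r \<le> A r" "A r \<le> M (2 * r)" if r: "r \<ge> 0" for r
  proof -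
    have "integral {1..2} (\<lambda>s::real. M r) \<le> A r"
      unfolding A_def by (rule integral_le) (use r Ms_int mult_left_mono[of 1 _ r] in \<open>auto intro!: M_mono\<close>)
    then show "M r \<le> A r" by simp
    have "A r \<le> integral {1..2} (\<lambda>s::real. M (2 * r))"
      unfolding A_def
      by (rule integral_le) (use r Ms_int mult_left_mono[of _ 2 r] in \<open>auto intro!: M_mono simp: mult.commute[of 2]\<close>)
    then show "A r \<le> M (2 * r)" by simp
  qed
  define J where "J r = integral {0..r} M" for r
  \<comment> \<open>Substituting \<open>r * s\<close> expresses the average through the indefinite
    integral \<open>J\<close>, which is continuous although \<open>M\<close> may jump. Hence
    \<open>A\<close> is continuous at positive \<open>r\<close>.\<close>
  have A_J: "A r = (J (2 * r) - J r) / r" if r: "r > 0" for r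
  proof -
    have img: "(\<lambda>x. x / r) ` {r..2 * r} = {1..2}"
      using r by (auto simp: field_simps image_iff intro!: bexI[of _ "_ * r"])
    have "((\<lambda>x. M (r * x)) has_integral (1 / \<bar>r\<bar>) *\<^sub>R integral {r..2 * r} M) {1..2}"
      using has_integral_stretch_real[OF integrable_integral[OF M_int], of r r "2 * r"] r img by simp
    then have "A r = integral {r..2 * r} M / r"
      unfolding A_def using r by (auto simp: integral_unique)
    moreover have "J r + integral {r..2 * r} M = J (2 * r)"
      unfolding J_def by (rule Henstock_Kurzweil_Integration.integral_combine) (use r M_int in auto)
    ultimately show ?thesis by simp
  qed
  have J_cont: "continuous_on {0..R} J" for R
    unfolding J_def by (rule indefinite_integral_continuous_1[OF M_int])
  have J_isCont: "isCont J r" if "r > 0" for r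
    using J_cont[of "r + 1"] that by (intro continuous_on_interior[of "{0..r + 1}"]) auto
  have A_cont: "continuous_on {0..} A"
    unfolding continuous_on_eq_continuous_within
  proof
    fix r :: real assume "r \<in> {0..}"
    show "continuous (at r within {0..}) A"
    proof (cases "r = 0")
      case True
      have "\<exists>d>0. \<forall>x\<in>{0..}. dist x 0 < d \<longrightarrow> dist (A x) (A 0) < e" if e: "e > 0" for e
      proof -
        obtain d where d: "d > 0" "M d \<le> e / 2" using M_small[of "e / 2"] e by auto
        have "A 0 = 0" using A_bounds[of 0] M_0 by simp
        moreover have "\<bar>A x\<bar> < e" if "x \<ge> 0" "x < d / 2" for x
          using A_bounds[OF that(1)] M_nonneg[of x] M_mono[of "2 * x" d] that(2) d(2) e by simp
        ultimately show ?thesis using d(1) by (intro exI[of _ "d / 2"]) (auto simp: dist_real_def)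
      qed
      then show ?thesis using True by (simp add: continuous_within_eps_delta)
    next
      case False
      with \<open>r \<in> {0..}\<close> have r: "r > 0" by simp
      have "isCont (\<lambda>r. (J (2 * r) - J r) / r) r"
        by (intro continuous_intros isCont_o2[where f = "\<lambda>r. 2 * r" and g = J] J_isCont) (use r in auto)
      moreover have "\<forall>\<^sub>F x in nhds r. (J (2 * x) - J x) / x = A x"
        using eventually_nhds_in_open[of "{0<..}" r] r by (auto elim!: eventually_mono simp: A_J)
      ultimately have "isCont A r" by (simp add: isCont_cong)
      then show ?thesis by (rule continuous_at_imp_continuous_at_within)
    qed
  qed
  have A_mono: "mono_on {0..} A"
    unfolding A_def by (rule mono_onI, rule integral_le)
      (use Ms_int in \<open>auto intro!: M_mono mult_right_mono\<close>)
  have "class_Kinf (\<lambda>r. r + A r)"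
    by (rule class_Kinf_add_mono[OF class_Kinf_id A_cont _ A_mono]) (use A_bounds[of 0] M_0 in simp)
  moreover have "h p \<le> size p + A (size p)" for p
    using M_ge[OF order.refl, of p] A_bounds(1)[OF size, of p] size[of p] by simp
  ultimately show ?thesis using that by blast
qed

text \<open>
  Adding \<open>ln\<close> to \<open>F\<close> turns it into a homeomorphism of the half-line onto the reals and weakens
  the inequality \<open>F y \<le> F a - s\<close> for \<open>y \<le> a\<close>.
\<close>
lemma decay_bound_exists:
  fixes F :: "real \<Rightarrow> real"
  assumes F_cont: "continuous_on {0<..} F" and F_mono: "mono_on {0<..} F"
  obtains b :: "real \<Rightarrow> real \<Rightarrow> real" where
    "\<And>s. 0 \<le> s \<Longrightarrow> continuous_on {0..} (\<lambda>a. b a s)" "\<And>s. b 0 s = 0"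
    "\<And>a a' s. 0 \<le> a \<Longrightarrow> a \<le> a' \<Longrightarrow> b a s \<le> b a' s"
    "\<And>a. continuous_on UNIV (b a)" "\<And>a s s'. s \<le> s' \<Longrightarrow> b a s' \<le> b a s"
    "\<And>a. (b a \<longlongrightarrow> 0) at_top"
    "\<And>y a s. 0 < y \<Longrightarrow> y \<le> a \<Longrightarrow> F y \<le> F a - s \<Longrightarrow> y \<le> b a s"
proof -
  define Q where "Q r = F r + ln r" for r
  have Q_cont: "continuous_on {0<..} Q"
    unfolding Q_def by (intro continuous_intros F_cont) auto
  have F_le: "F r \<le> F s" if "0 < r" "r \<le> s" for r s
    using F_mono that by (auto simp: mono_on_def)
  have Q_less: "Q r < Q s" if "0 < r" "r < s" for r s
    unfolding Q_def using F_le[of r s] that by (simp add: add_le_less_mono)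
  have Q_less_iff: "Q r < Q s \<longleftrightarrow> r < s" if "0 < r" "0 < s" for r s
    using Q_less[of r s] Q_less[of s r] that by (cases r s rule: linorder_cases) auto
  have Q_le_iff: "Q r \<le> Q s \<longleftrightarrow> r \<le> s" if "0 < r" "0 < s" for r s
    using Q_less_iff[of s r] that by auto
  have onto: "Q ` {0<..} = UNIV"
  proof (intro equalityI subset_UNIV subsetI)
    fix z :: real
    \<comment> \<open>At \<open>exp (z - F 1)\<close> the logarithm equals \<open>z - F 1\<close>.
      Capping this point by 1 from above and from below allows \<open>F\<close> to be compared with
      \<open>F 1\<close>, so that \<open>z\<close> lies between \<open>Q y1\<close> and
      \<open>Q y2\<close>.\<close>
    define y1 where "y1 = min 1 (exp (z - F 1))"
    define y2 where "y2 = max 1 (exp (z - F 1))"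
    have y: "0 < y1" "y1 \<le> 1" "1 \<le> y2" by (auto simp: y1_def y2_def)
    have "ln y1 \<le> ln (exp (z - F 1))" unfolding y1_def by (subst ln_le_cancel_iff) auto
    then have 1: "Q y1 \<le> z" using F_le[of y1 1] y by (simp add: Q_def)
    have "ln (exp (z - F 1)) \<le> ln y2" unfolding y2_def by (subst ln_le_cancel_iff) auto
    then have 2: "z \<le> Q y2" using F_le[of 1 y2] y by (simp add: Q_def)
    have "continuous_on {y1..y2} Q"
      by (rule continuous_on_subset[OF Q_cont]) (use y in auto)
    from IVT'[OF 1 2 _ this] y obtain x where "x \<ge> y1" "Q x = z" by auto
    then show "z \<in> Q ` {0<..}" using y by (intro image_eqI[of _ _ x]) auto
  qed
  have inj: "inj_on Q {0<..}"
    using Q_less by (intro linorder_inj_onI) (auto simp: less_le)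
  obtain H where hom: "homeomorphism {0<..} UNIV Q H"
    using homeomorphism_into_1d[OF _ Q_cont onto inj] convex_imp_path_connected by blast
  have H: "H (Q r) = r" if "r > 0" for r using hom that by (auto simp: homeomorphism_def)
  have Q_H: "Q (H z) = z" for z using hom by (auto simp: homeomorphism_def)
  have H_pos: "H z > 0" for z using hom by (auto simp: homeomorphism_def)
  have H_cont: "continuous_on UNIV H" using hom by (auto simp: homeomorphism_def)
  have H_le: "H z \<le> r \<longleftrightarrow> z \<le> Q r" "r \<le> H z \<longleftrightarrow> Q r \<le> z" if "r > 0" for r z
    using Q_le_iff[of "H z" r] Q_le_iff[of r "H z"] that H_pos Q_H by auto
  have H_mono: "H w \<le> H z" if "w \<le> z" for w z
    using H_le(1)[of "H z" w] H_pos Q_H that by auto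
  \<comment> \<open>\<open>b a s\<close> is the level reached from \<open>a\<close> when
    \<open>Q\<close> drops by \<open>s\<close>. The value 0 at \<open>a = 0\<close> is set by hand;
    continuity there follows from squeezing between 0 and \<open>a\<close>.\<close>
  define b where "b a s = (if a \<le> 0 then 0 else H (Q a - s))" for a s
  have b_nonneg: "0 \<le> b a s" for a s using H_pos by (auto simp: b_def less_imp_le)
  have b_le: "b a s \<le> a" if "0 \<le> a" "0 \<le> s" for a s
    using that H_le(1)[of a "Q a - s"] by (auto simp: b_def)
  show ?thesis
  proof
    show "continuous_on {0..} (\<lambda>a. b a s)" if s: "s \<ge> 0" for s
      unfolding continuous_on_eq_continuous_within
    proof
      fix a :: real assume "a \<in> {0..}"
      show "continuous (at a within {0..}) (\<lambda>a. b a s)"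
      proof (cases "a = 0")
        case True
        have "((\<lambda>a. b a s) \<longlongrightarrow> 0) (at 0 within {0..})"
          by (rule tendsto_sandwich[of "\<lambda>_. 0" _ _ "\<lambda>a. a"])
             (auto simp: eventually_at b_nonneg s intro!: b_le exI[of _ 1])
        then show ?thesis using True by (simp add: continuous_within b_def)
      next
        case False
        with \<open>a \<in> {0..}\<close> have a: "a > 0" by simp
        have "isCont Q a"
          using Q_cont a by (simp add: continuous_on_eq_continuous_at)
        moreover have "isCont H z" for z
          using H_cont by (simp add: continuous_on_eq_continuous_at)
        ultimately have "isCont (\<lambda>a. H (Q a - s)) a"
          by (intro continuous_intros isCont_o2[where f = "\<lambda>a. Q a - s" and g = H])
        moreover have "\<forall>\<^sub>F x in nhds a. H (Q x - s) = b x s"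
          using eventually_nhds_in_open[of "{0<..}" a] a by (auto elim!: eventually_mono simp: b_def)
        ultimately have "isCont (\<lambda>a. b a s) a" by (simp add: isCont_cong)
        then show ?thesis by (rule continuous_at_imp_continuous_at_within)
      qed
    qed
    show "b 0 s = 0" for s by (simp add: b_def)
    show "b a s \<le> b a' s" if "0 \<le> a" "a \<le> a'" for a a' s
      using that Q_le_iff[of a a'] H_pos by (auto simp: b_def less_imp_le intro!: H_mono)
    show "continuous_on UNIV (b a)" for a
      unfolding b_def by (cases "a \<le> 0") (auto intro!: continuous_intros continuous_on_compose2[OF H_cont])
    show "b a s' \<le> b a s" if "s \<le> s'" for a s s'
      using that by (auto simp: b_def intro!: H_mono)
    show "(b a \<longlongrightarrow> 0) at_top" for a
    proof (rule order_tendstoI)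
      fix e :: real assume "e < 0"
      then show "\<forall>\<^sub>F s in at_top. e < b a s"
        using b_nonneg by (auto intro!: always_eventually intro: less_le_trans)
    next
      fix e :: real assume e: "0 < e"
      have "b a s < e" if "s \<ge> Q a - Q (e / 2)" for s
        using that e H_le(1)[of "e / 2" "Q a - s"] by (auto simp: b_def)
      then show "\<forall>\<^sub>F s in at_top. b a s < e"
        by (rule eventually_at_top_linorderI)
    qed
    show "y \<le> b a s" if "0 < y" "y \<le> a" "F y \<le> F a - s" for y a s
    proof -
      have "ln y \<le> ln a" using that by simp
      then have "Q y \<le> Q a - s" unfolding Q_def using that(3) by linarith
      then show ?thesis using that by (simp add: b_def H_le(2))
    qed
  qed
qed

text \<open>The term \<open>r / (1 + t)\<close> is strictly increasing in \<open>r\<close>, strictly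
  decreasing in \<open>t\<close> for positive \<open>r\<close>, and tends to 0. It supplies the
  strictness that a weakly monotone bound lacks, at the price of enlarging the bound.\<close>

lemma class_KL_add_strict:
  fixes b :: "real \<Rightarrow> real \<Rightarrow> real"
  assumes cont1: "\<And>t. 0 \<le> t \<Longrightarrow> continuous_on {0..} (\<lambda>r. b r t)" and zero: "\<And>t. 0 \<le> t \<Longrightarrow> b 0 t = 0"
    and mono: "\<And>r r' t. 0 \<le> t \<Longrightarrow> 0 \<le> r \<Longrightarrow> r \<le> r' \<Longrightarrow> b r t \<le> b r' t"
    and cont2: "\<And>r. 0 < r \<Longrightarrow> continuous_on {0..} (b r)"
    and anti: "\<And>r t t'. 0 < r \<Longrightarrow> 0 \<le> t \<Longrightarrow> t \<le> t' \<Longrightarrow> b r t' \<le> b r t"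
    and lim: "\<And>r. 0 < r \<Longrightarrow> (b r \<longlongrightarrow> 0) at_top"
  shows "class_KL (\<lambda>r t. b r t + r / (1 + t))"
  unfolding class_KL_def
proof (intro conjI allI impI)
  fix t :: real assume t: "t \<ge> 0"
  have str: "b r t + r / (1 + t) < b r' t + r' / (1 + t)" if "0 \<le> r" "r < r'" for r r'
    using mono[OF t that(1), of r'] that t by (intro add_le_less_mono) (auto simp: divide_strict_right_mono)
  have "0 < b r t + r / (1 + t)" if "0 < r" for r
    using str[of 0 r] that zero[OF t] by simp
  then show "class_K (\<lambda>r. b r t + r / (1 + t))"
    unfolding class_K_def class_P_def using str t
    by (auto intro!: continuous_intros cont1 strict_mono_onI simp: zero)
next
  fix r :: real assume r: "r > 0"
  have nonneg: "0 \<le> b r t" if "t \<ge> 0" for t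
    using mono[OF that order.refl, of r] zero[OF that] r by simp
  have "filterlim (\<lambda>t::real. 1 + t) at_top at_top"
    by (intro filterlim_tendsto_add_at_top[OF tendsto_const] filterlim_ident)
  then have "((\<lambda>t. r / (1 + t)) \<longlongrightarrow> 0) at_top"
    by (rule real_tendsto_divide_at_top[OF tendsto_const])
  from tendsto_add[OF lim[OF r] this]
  have "((\<lambda>t. b r t + r / (1 + t)) \<longlongrightarrow> 0 + 0) at_top" .
  moreover have "b r t' + r / (1 + t') < b r t + r / (1 + t)" if "0 \<le> t" "t < t'" for t t'
    using anti[OF r that(1), of t'] that r by (intro add_le_less_mono) (auto intro!: divide_strict_left_mono)
  ultimately show "class_L (\<lambda>t. b r t + r / (1 + t))"
    unfolding class_L_def using r nonneg
    by (auto intro!: continuous_intros cont2 add_nonneg_nonneg simp: monotone_on_def)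
qed

subsection \<open>Flows and impulses\<close>

text \<open>Total differentiability is already part of \<open>C_diff\<close>, so it remains to
  expand the derivative in the standard basis.\<close>

lemma smooth_has_derivative_grad:
  fixes V :: "real^'n \<Rightarrow> real"
  assumes "smooth V"
  shows "(V has_derivative (\<lambda>h. grad V x \<bullet> h)) (at x)" and "continuous_on UNIV (grad V)"
proof -
  have "C_diff (Suc 0) V" using assms unfolding smooth_def by blast
  then have diff: "V differentiable (at x)" and cont: "\<And>i. continuous_on UNIV (partial_deriv i V)" for x
    by auto
  let ?L = "frechet_derivative V (at x)"
  have der: "(V has_derivative ?L) (at x)" using diff frechet_derivative_works by blast
  then interpret L: bounded_linear ?L by (rule has_derivative_bounded_linear)
  have "?L h = grad V x \<bullet> h" for h
  proof -
    have "?L h = ?L (\<Sum>i\<in>UNIV. (h $ i) *\<^sub>R axis i 1)"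
      using basis_expansion[of h] by (simp add: scalar_mult_eq_scaleR)
    also have "\<dots> = (\<Sum>i\<in>UNIV. h $ i * ?L (axis i 1))"
      by (simp add: L.sum L.scaleR)
    also have "\<dots> = grad V x \<bullet> h"
      by (simp add: inner_vec_def grad_def partial_deriv_def mult.commute)
    finally show ?thesis .
  qed
  then have "?L = (\<lambda>h. grad V x \<bullet> h)" by blast
  with der show "(V has_derivative (\<lambda>h. grad V x \<bullet> h)) (at x)" by simp
  show "continuous_on UNIV (grad V)"
    unfolding grad_def by (intro continuous_on_vec_lambda cont)
qed

lemma smooth_isCont: "smooth V \<Longrightarrow> isCont V x"
  by (rule has_derivative_continuous[OF smooth_has_derivative_grad(1)])

text \<open>The gradient is bounded on the compact ball, and convexity of the ball turns this into a
  Lipschitz bound.\<close>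

lemma smooth_lipschitz_on_cball:
  fixes V :: "real^'n \<Rightarrow> real"
  assumes "smooth V"
  obtains L where "L-lipschitz_on (cball 0 R) V"
proof -
  have "compact (grad V ` cball 0 R)"
    using smooth_has_derivative_grad(2)[OF assms] continuous_on_subset
    by (intro compact_continuous_image) auto
  then obtain B where B: "\<And>x. x \<in> cball 0 R \<Longrightarrow> norm (grad V x) \<le> B"
    using compact_imp_bounded by (fastforce simp: bounded_iff)
  have "\<bar>B\<bar>-lipschitz_on (cball 0 R) V"
  proof (rule bounded_derivative_imp_lipschitz)
    show "(V has_derivative (\<lambda>h. grad V x \<bullet> h)) (at x within cball 0 R)" for x
      using smooth_has_derivative_grad(1)[OF assms] has_derivative_at_withinI by blast
    show "onorm (\<lambda>h. grad V x \<bullet> h) \<le> \<bar>B\<bar>" if "x \<in> cball 0 R" for x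
    proof (rule onorm_le)
      fix h
      have "norm (grad V x \<bullet> h) \<le> norm (grad V x) * norm h" by (simp add: Cauchy_Schwarz_ineq2)
      also have "\<dots> \<le> \<bar>B\<bar> * norm h" using B[OF that] by (intro mult_right_mono) auto
      finally show "norm (grad V x \<bullet> h) \<le> \<bar>B\<bar> * norm h" .
    qed
  qed auto
  then show ?thesis using that by blast
qed

text \<open>\<open>1 / \<phi>\<close> may blow up at 0, but it is bounded on compact intervals of
  positive numbers.\<close>

lemma lipschitz_on_reciprocal_antiderivative:
  fixes F \<phi> :: "real \<Rightarrow> real"
  assumes F: "\<And>r. 0 < r \<Longrightarrow> (F has_real_derivative 1 / \<phi> r) (at r)"
    and \<phi>: "continuous_on {0<..} \<phi>" "\<And>r. 0 < r \<Longrightarrow> 0 < \<phi> r" and m: "0 < m"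
  obtains L where "L-lipschitz_on {m..M} F"
proof -
  have "\<phi> r \<noteq> 0" if "r \<in> {m..M}" for r using \<phi>(2)[of r] that m by auto
  then have "continuous_on {m..M} (\<lambda>r. 1 / \<phi> r)"
    using m by (intro continuous_intros continuous_on_subset[OF \<phi>(1)]) auto
  then have "bounded ((\<lambda>r. 1 / \<phi> r) ` {m..M})"
    by (intro compact_imp_bounded compact_continuous_image) auto
  then obtain B where "\<forall>y\<in>(\<lambda>r. 1 / \<phi> r) ` {m..M}. norm y \<le> B" unfolding bounded_iff by blast
  then have B: "\<And>r. r \<in> {m..M} \<Longrightarrow> norm (1 / \<phi> r) \<le> B" by blast
  have "\<bar>B\<bar>-lipschitz_on {m..M} F"
  proof (rule bounded_derivative_imp_lipschitz[where f' = "\<lambda>r. (*) (1 / \<phi> r)"])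
    fix r assume r: "r \<in> {m..M}"
    then have "0 < r" using m by simp
    then have "(F has_derivative (\<lambda>h. 1 / \<phi> r * h)) (at r)"
      using F unfolding has_field_derivative_def by blast
    then show "(F has_derivative (\<lambda>h. 1 / \<phi> r * h)) (at r within {m..M})"
      by (rule has_derivative_at_withinI)
    show "onorm ((*) (1 / \<phi> r)) \<le> \<bar>B\<bar>" 
    proof (rule onorm_le)
      fix h :: real
      have "norm (1 / \<phi> r) \<le> \<bar>B\<bar>" using B[OF r] by linarith
      then show "norm (1 / \<phi> r * h) \<le> \<bar>B\<bar> * norm h"
        unfolding norm_mult by (rule mult_right_mono) simp
    qed
  qed auto
  then show ?thesis using that by blast
qed

text \<open>By the chain rule, \<open>F (V (x r))\<close> has derivative at most -1 outside
  \<open>N\<close>, and absolute continuity turns this into a bound on the increment. Positivity of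
  \<open>V\<close> on the compact time interval keeps its values away from the possible singularity
  of \<open>F\<close> at 0.\<close>

lemma flow_increment_le:
  fixes x :: "real \<Rightarrow> real^'n"
  assumes V: "smooth V"
    and F: "\<And>r. 0 < r \<Longrightarrow> (F has_real_derivative 1 / \<phi> r) (at r)"
    and \<phi>: "continuous_on {0<..} \<phi>" "\<And>r. 0 < r \<Longrightarrow> 0 < \<phi> r"
    and ac: "absolutely_continuous_on_Icc s t x" and st: "s \<le> t" and N: "negligible N"
    and pos: "\<And>r. r \<in> {s..t} \<Longrightarrow> 0 < V (x r)"
    and der: "\<And>r. r \<in> {s..t} - N \<Longrightarrow> (x has_vector_derivative w r) (at r)"
    and decr: "\<And>r. r \<in> {s..t} - N \<Longrightarrow> grad V (x r) \<bullet> w r \<le> - \<phi> (V (x r))"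
  shows "F (V (x t)) \<le> F (V (x s)) - (t - s)"
proof -
  have cont: "continuous_on {s..t} x"
    by (rule absolutely_continuous_on_Icc_imp_continuous_on[OF ac])
  have "compact (x ` {s..t})" by (rule compact_continuous_image[OF cont]) simp
  then obtain R where "\<And>r. r \<in> {s..t} \<Longrightarrow> norm (x r) \<le> R"
    using compact_imp_bounded by (fastforce simp: bounded_iff)
  then have R: "x ` {s..t} \<subseteq> cball 0 R" by auto
  obtain L where "L-lipschitz_on (cball 0 R) V" using smooth_lipschitz_on_cball[OF V] .
  then have "L-lipschitz_on (x ` {s..t}) V" using R lipschitz_on_subset by blast
  then have acV: "absolutely_continuous_on_Icc s t (\<lambda>r. V (x r))"
    by (rule absolutely_continuous_on_Icc_lipschitz_compose[OF ac])
  then have contV: "continuous_on {s..t} (\<lambda>r. V (x r))"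
    by (rule absolutely_continuous_on_Icc_imp_continuous_on)
  obtain r1 where r1: "r1 \<in> {s..t}" "\<And>r. r \<in> {s..t} \<Longrightarrow> V (x r1) \<le> V (x r)"
    using continuous_attains_inf[OF _ _ contV] st by auto
  obtain r2 where r2: "r2 \<in> {s..t}" "\<And>r. r \<in> {s..t} \<Longrightarrow> V (x r) \<le> V (x r2)"
    using continuous_attains_sup[OF _ _ contV] st by auto
  obtain L' where "L'-lipschitz_on {V (x r1)..V (x r2)} F"
    using lipschitz_on_reciprocal_antiderivative[where F = F and \<phi> = \<phi>, OF F \<phi> pos[OF r1(1)]] by blast
  then have "L'-lipschitz_on ((\<lambda>r. V (x r)) ` {s..t}) F"
    using r1(2) r2(2) by (elim lipschitz_on_subset) auto
  then have acF: "absolutely_continuous_on_Icc s t (\<lambda>r. F (V (x r)))"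
    by (rule absolutely_continuous_on_Icc_lipschitz_compose[OF acV])
  have "F (V (x t)) - F (V (x s)) \<le> (- 1) * (t - s)"
  proof (rule absolutely_continuous_on_Icc_increment_le[OF acF st N])
    fix r assume r: "r \<in> {s..t} - N"
    have v: "V (x r) > 0" using pos r by blast
    have "((\<lambda>r. V (x r)) has_derivative (\<lambda>h. grad V (x r) \<bullet> (h *\<^sub>R w r))) (at r)"
      using has_derivative_compose[OF der[OF r, unfolded has_vector_derivative_def]
          smooth_has_derivative_grad(1)[OF V]] .
    then have "((\<lambda>r. V (x r)) has_real_derivative grad V (x r) \<bullet> w r) (at r)"
      unfolding has_field_derivative_def by (simp add: mult.commute[of _ "grad V (x r) \<bullet> w r"] mult_commute_abs)
    from DERIV_chain2[OF F[OF v] this]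
    have "((\<lambda>r. F (V (x r))) has_vector_derivative 1 / \<phi> (V (x r)) * (grad V (x r) \<bullet> w r)) (at r)"
      by (simp add: has_real_derivative_iff_has_vector_derivative)
    moreover have "1 / \<phi> (V (x r)) * (grad V (x r) \<bullet> w r) \<le> - 1"
      using decr[OF r] \<phi>(2)[OF v] by (simp add: divide_le_eq)
    ultimately show "\<exists>D\<le>- 1. ((\<lambda>r. F (V (x r))) has_vector_derivative D) (at r)" by blast
  qed
  then show ?thesis by simp
qed

text \<open>
  A trajectory cannot leave the sublevel set at level \<open>c\<close>: otherwise it would first pass
  through a level strictly between \<open>c\<close> and its final value, and then decrease.
\<close>
lemma flow_stays_above:
  fixes v F :: "real \<Rightarrow> real"
  assumes F: "strict_mono_on {0<..} F" and c: "0 \<le> c" and cont: "continuous_on {s..t} v"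
    and decr: "\<And>r. r \<in> {s..t} \<Longrightarrow> \<forall>q\<in>{r..t}. c < v q \<Longrightarrow> F (v t) \<le> F (v r) - (t - r)"
    and vt: "c < v t" and q: "q \<in> {s..t}"
  shows "c < v q"
proof (rule ccontr)
  assume "\<not> c < v q"
  then have ne: "{r \<in> {s..t}. v r \<le> c} \<noteq> {}" using q by auto
  have "closed {r \<in> {s..t}. v r \<le> c}"
    by (rule continuous_on_closed_Collect_le[OF cont]) auto
  then have "compact {r \<in> {s..t}. v r \<le> c}"
    unfolding compact_eq_bounded_closed by (auto intro: bounded_subset[of "{s..t}"])
  \<comment> \<open>\<open>r0\<close> is the last time with level at most \<open>c\<close>, so
    everything after it is strictly above \<open>c\<close> and the decrease is available there,
    though not at \<open>r0\<close> itself.\<close>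
  then obtain r0 where r0: "r0 \<in> {s..t}" "v r0 \<le> c" and last: "\<And>r. r \<in> {s..t} \<Longrightarrow> v r \<le> c \<Longrightarrow> r \<le> r0"
    using compact_attains_sup[OF _ ne] by auto
  have "\<exists>r\<ge>r0. r \<le> t \<and> v r = (c + v t) / 2"
    by (rule IVT') (use r0 vt in \<open>auto intro: continuous_on_subset[OF cont]\<close>)
  then obtain r where r: "r0 \<le> r" "r \<le> t" "v r = (c + v t) / 2" by blast
  with r0 vt have r0r: "r0 < r" by (cases "r = r0") auto
  have "\<forall>q\<in>{r..t}. c < v q"
  proof
    fix q assume "q \<in> {r..t}"
    then show "c < v q" using last[of q] r0r r0(1) by (cases "v q \<le> c") auto
  qed
  then have "F (v t) \<le> F (v r) - (t - r)" using r(1,2) r0(1) by (intro decr) auto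
  then have "F (v t) \<le> F (v r)" using r(2) by simp
  then have "v t \<le> v r"
    using strict_mono_on_less_eq[OF F] r(3) c vt by auto
  then show False using r(3) vt by simp
qed

text \<open>The scalar core of the argument: \<open>v\<close> stands for \<open>V\<close> along a
  solution, \<open>vm\<close> for its left limits, and \<open>G\<close> for the level controlled by
  the input. An invariant is carried from impulse to impulse by induction and then extended to the
  times in between.\<close>

lemma hybrid_bound:
  fixes v vm F \<alpha> A :: "real \<Rightarrow> real" and \<tau> :: "nat \<Rightarrow> real"
  assumes F: "strict_mono_on {0<..} F" and c: "0 \<le> c" and \<delta>: "0 < \<delta>" "\<delta> \<le> \<theta>"
    and \<tau>: "t0 \<le> \<tau> 0" "\<And>i. \<tau> (Suc i) - \<tau> i \<ge> \<theta>" and v: "\<And>t. 0 \<le> v t"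
    and flow: "\<And>s t. t0 \<le> s \<Longrightarrow> s \<le> t \<Longrightarrow> {s<..t} \<inter> range \<tau> = {} \<Longrightarrow>
       v t \<le> c \<or> c < v s \<and> F (v t) \<le> F (v s) - (t - s)"
    and flowl: "\<And>s t. t0 \<le> s \<Longrightarrow> s < t \<Longrightarrow> {s<..<t} \<inter> range \<tau> = {} \<Longrightarrow>
       vm t \<le> c \<or> c < v s \<and> F (vm t) \<le> F (v s) - (t - s)"
    and jump_small: "\<And>i. t0 < \<tau> i \<Longrightarrow> vm (\<tau> i) \<le> c \<Longrightarrow> v (\<tau> i) \<le> G"
    and jump_large: "\<And>i. t0 < \<tau> i \<Longrightarrow> c < vm (\<tau> i) \<Longrightarrow> v (\<tau> i) \<le> \<alpha> (vm (\<tau> i))"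
    and \<alpha>: "\<And>a. 0 < a \<Longrightarrow> 0 < \<alpha> a" "\<And>a. 0 < a \<Longrightarrow> F (\<alpha> a) \<le> F a + (\<theta> - \<delta>)"
    and A: "\<And>a. 0 \<le> a \<Longrightarrow> a \<le> A a" "\<And>a b. 0 < a \<Longrightarrow> a \<le> b \<Longrightarrow> \<alpha> a \<le> A b"
    and G: "c \<le> G" and t: "t0 \<le> t"
  shows "v t \<le> G \<or> 0 < v t \<and> v t \<le> A (v t0) \<and> F (v t) \<le> F (A (v t0)) - \<delta> / \<theta> * max 0 (t - \<tau> 0)"
proof -
  define A0 where "A0 = A (v t0)"
  \<comment> \<open>The net decay rate. A jump raises \<open>F\<close> by at most
    \<open>\<theta> - \<delta> = (1 - \<eta>) * \<theta>\<close>, which is at most the fraction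
    \<open>1 - \<eta>\<close> of the gap before it, while the flow lowers \<open>F\<close> by the
    whole gap.\<close>
  define \<eta> where "\<eta> = \<delta> / \<theta>"
  have \<theta>: "\<theta> > 0" using \<delta> by simp
  have \<eta>: "0 \<le> \<eta>" "\<eta> \<le> 1" "\<theta> - \<delta> = (1 - \<eta>) * \<theta>"
    unfolding \<eta>_def using \<delta> \<theta> by (auto simp: field_simps)
  have Fle: "F a \<le> F b \<longleftrightarrow> a \<le> b" if "0 < a" "0 < b" for a b
    using strict_mono_on_less_eq[OF F] that by auto
  have G0: "G \<ge> 0" using c G by simp
  have A0v: "v t0 \<le> A0" unfolding A0_def by (rule A(1)[OF v])
  have \<tau>_step: "\<tau> i < \<tau> (Suc i)" for i using \<tau>(2)[of i] \<theta> by simp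
  then have mono: "strict_mono \<tau>" by (simp add: strict_mono_Suc_iff)
  have \<tau>_ge: "\<tau> 0 \<le> \<tau> i" for i using mono by (simp add: strict_mono_less_eq)
  have gap: "\<not> (\<tau> i < \<tau> j \<and> \<tau> j < \<tau> (Suc i))" for i j
    using mono by (simp add: strict_mono_less)
  \<comment> \<open>The invariant for level \<open>w\<close> at time \<open>s\<close> after the
    first impulse. \<open>0 < A0\<close> is included because \<open>F\<close> is comparable only at
    positive arguments.\<close>
  define P where "P w s \<longleftrightarrow> w \<le> G \<or> 0 < w \<and> 0 < A0 \<and> F w \<le> F A0 - \<eta> * s" for w s
  \<comment> \<open>\<open>F\<close> says nothing at 0, hence the guarded premise; a vanishing
    \<open>w'\<close> is below \<open>G\<close> anyway. Since \<open>F\<close> does not increase, a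
    level below \<open>G\<close> stays there.\<close>
  have P_decr: "P w' s'"
    if "P w s" "0 < w" "0 \<le> w'" "0 < w' \<Longrightarrow> F w' \<le> F w - \<eta> * (s' - s)" "s \<le> s'" for w s w' s'
  proof (cases "w' = 0")
    case False
    with that have w': "0 < w'" "F w' \<le> F w - \<eta> * (s' - s)" by auto
    moreover have "0 \<le> \<eta> * (s' - s)" using \<eta> that(5) by simp
    ultimately have "w' \<le> w" using Fle[of w' w] that(2) by simp
    then show ?thesis using that(1) w' unfolding P_def by (auto simp: algebra_simps)
  qed (use G0 in \<open>simp add: P_def\<close>)
  have imp: "P (v (\<tau> i)) (\<tau> i - \<tau> 0)" for i
  proof (induction i)
    \<comment> \<open>The first impulse is absorbed by \<open>A\<close>, and no decay is credited to
      the time before it. If \<open>\<tau> 0 = t0\<close>, there is no jump and the initial level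
      itself is below \<open>A0\<close>.\<close>
    case 0
    have "v (\<tau> 0) \<le> G \<or> v (\<tau> 0) \<le> A0"
    proof (cases "\<tau> 0 = t0")
      case False
      then have lt: "t0 < \<tau> 0" using \<tau>(1) by simp
      have "{t0<..<\<tau> 0} \<inter> range \<tau> = {}" using \<tau>_ge by (auto simp: not_less[symmetric])
      from flowl[OF order.refl lt this] show ?thesis
      proof
        assume "vm (\<tau> 0) \<le> c"
        then show ?thesis using jump_small[OF lt] by simp
      next
        assume *: "c < v t0 \<and> F (vm (\<tau> 0)) \<le> F (v t0) - (\<tau> 0 - t0)"
        show ?thesis
        proof (cases "vm (\<tau> 0) \<le> c")
          case True
          then show ?thesis using jump_small[OF lt] by simp
        next
          case False
          then have pos: "0 < vm (\<tau> 0)" using c by simp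
          have "vm (\<tau> 0) \<le> v t0" using * pos c lt Fle[of "vm (\<tau> 0)" "v t0"] by simp
          then have "\<alpha> (vm (\<tau> 0)) \<le> A0" unfolding A0_def by (rule A(2)[OF pos])
          then show ?thesis using jump_large[OF lt] False by simp
        qed
      qed
    qed (use A0v in simp)
    then show ?case
      using v[of "\<tau> 0"] G0 Fle[of "v (\<tau> 0)" A0] unfolding P_def by (cases "v (\<tau> 0) = 0") auto
  next
    case (Suc i)
    have lt: "t0 < \<tau> (Suc i)" using \<tau>_step[of i] \<tau>_ge[of i] \<tau>(1) by simp
    have ge: "t0 \<le> \<tau> i" using \<tau>_ge[of i] \<tau>(1) by simp
    have empty: "{\<tau> i<..<\<tau> (Suc i)} \<inter> range \<tau> = {}" using gap by auto
    show ?case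
    proof (cases "vm (\<tau> (Suc i)) \<le> c")
      case True
      then show ?thesis using jump_small[OF lt] unfolding P_def by simp
    next
      case False
      with flowl[OF ge \<tau>_step empty]
      have *: "c < v (\<tau> i)" "F (vm (\<tau> (Suc i))) \<le> F (v (\<tau> i)) - (\<tau> (Suc i) - \<tau> i)" by auto
      have pos: "0 < vm (\<tau> (Suc i))" using False c by simp
      show ?thesis
      proof (rule P_decr[OF Suc])
        show "0 < v (\<tau> i)" using * c by simp
        show "0 \<le> v (\<tau> (Suc i))" by (rule v)
        show "\<tau> i - \<tau> 0 \<le> \<tau> (Suc i) - \<tau> 0" using \<tau>_step[of i] by simp
        assume w: "0 < v (\<tau> (Suc i))"
        have "F (v (\<tau> (Suc i))) \<le> F (\<alpha> (vm (\<tau> (Suc i))))"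
          using jump_large[OF lt] False \<alpha>(1)[OF pos] Fle[OF w] by simp
        also have "\<dots> \<le> F (vm (\<tau> (Suc i))) + (1 - \<eta>) * \<theta>" using \<alpha>(2)[OF pos] \<eta>(3) by simp
        \<comment> \<open>\<open>\<theta>\<close> is replaced by the actual gap, which is at least
          as long; the factor \<open>1 - \<eta>\<close> is nonnegative.\<close>
        also have "\<dots> \<le> F (v (\<tau> i)) - (\<tau> (Suc i) - \<tau> i) + (1 - \<eta>) * (\<tau> (Suc i) - \<tau> i)"
          using *(2) \<eta> \<tau>(2)[of i] by (intro add_mono mult_left_mono) auto
        finally show "F (v (\<tau> (Suc i))) \<le> F (v (\<tau> i)) - \<eta> * (\<tau> (Suc i) - \<tau> 0 - (\<tau> i - \<tau> 0))"
          by (simp add: algebra_simps)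
      qed
    qed
  qed
  have "P (v t) (max 0 (t - \<tau> 0))"
  proof (cases "t < \<tau> 0")
    case True
    have "\<not> \<tau> i \<le> t" for i using True \<tau>_ge[of i] by simp
    then have "{t0<..t} \<inter> range \<tau> = {}" by auto
    from flow[OF order.refl t this] show ?thesis
    proof
      assume *: "c < v t0 \<and> F (v t) \<le> F (v t0) - (t - t0)"
      then have "F (v t) \<le> F A0" using Fle[of "v t0" A0] A0v c t by simp
      then show ?thesis using True v[of t] G0 * A0v c unfolding P_def by (cases "v t = 0") auto
    qed (use G in \<open>simp add: P_def\<close>)
  next
    case False
    have lin: "\<tau> 0 + real i * \<theta> \<le> \<tau> i" for i
    proof (induction i)
      case (Suc i)
      then show ?case using \<tau>(2)[of i] by (simp add: algebra_simps)
    qed simp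
    obtain n where "t - \<tau> 0 < real n * \<theta>" using reals_Archimedean3[OF \<theta>] by blast
    then have "t < \<tau> n" using lin[of n] by simp
    \<comment> \<open>The least index of an impulse after \<open>t\<close> is positive here, so its
      predecessor is the last impulse up to \<open>t\<close>.\<close>
    then have "\<exists>n. t < \<tau> n \<and> (\<forall>k<n. \<not> t < \<tau> k)" by (rule exists_least_iff[THEN iffD1, OF exI])
    then obtain n where n: "t < \<tau> n" "\<And>k. k < n \<Longrightarrow> \<not> t < \<tau> k" by blast
    with False obtain i where i: "n = Suc i" by (cases n) auto
    have ti: "\<tau> i \<le> t" "t < \<tau> (Suc i)" using n(1) n(2)[of i] i by auto
    have "\<not> (\<tau> i < \<tau> j \<and> \<tau> j \<le> t)" for j using gap[of i j] ti(2) by auto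
    then have "{\<tau> i<..t} \<inter> range \<tau> = {}" by auto
    from flow[OF _ ti(1) this] \<tau>(1) \<tau>_ge[of i]
    have "v t \<le> c \<or> c < v (\<tau> i) \<and> F (v t) \<le> F (v (\<tau> i)) - (t - \<tau> i)" by simp
    then show ?thesis
    proof
      assume *: "c < v (\<tau> i) \<and> F (v t) \<le> F (v (\<tau> i)) - (t - \<tau> i)"
      \<comment> \<open>Within the incomplete last gap \<open>F\<close> drops at rate at least 1,
        hence at rate at least \<open>\<eta>\<close>.\<close>
      have "\<eta> * (t - \<tau> i) \<le> 1 * (t - \<tau> i)" using \<eta> ti by (intro mult_right_mono) auto
      then have "P (v t) (t - \<tau> 0)"
        using * c ti(1) v[of t] by (intro P_decr[OF imp[of i]]) auto
      then show ?thesis using False by (simp add: max_def)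
    qed (use G in \<open>simp add: P_def\<close>)
  qed
  moreover have "F (v t) \<le> F A0 - \<eta> * max 0 (t - \<tau> 0) \<Longrightarrow> F (v t) \<le> F A0"
    using \<eta>(1) mult_nonneg_nonneg[of \<eta> "max 0 (t - \<tau> 0)"] by linarith
  ultimately show ?thesis
    using Fle[of "v t" A0] unfolding P_def A0_def \<eta>_def by auto
qed

section \<open>Left limits, bounds on the input, and Lyapunov estimates along solutions\<close>

lemma left_limit_tendsto:
  assumes "right_continuous_with_left_limits t0 h" "t0 < t"
  shows "(h \<longlongrightarrow> left_limit h t) (at_left t)"
proof -
  obtain l where "(h \<longlongrightarrow> l) (at_left t)"
    using assms unfolding right_continuous_with_left_limits_def by blast
  then show ?thesis
    unfolding left_limit_def by (simp add: tendsto_Lim trivial_limit_at_left_real)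
qed

lemma norm_le_sup_norm:
  assumes "admissible_input t0 u" "t0 \<le> t"
  shows "norm (u t) \<le> sup_norm t0 u"
proof -
  have "bdd_above ((\<lambda>t. norm (u t)) ` {t0..})"
    using assms(1) unfolding admissible_input_def bounded_iff by (auto intro: bdd_aboveI2)
  then show ?thesis unfolding sup_norm_def using assms(2) by (intro cSUP_upper) auto
qed

lemma sup_norm_nonneg:
  assumes "admissible_input t0 u"
  shows "0 \<le> sup_norm t0 u"
  using norm_le_sup_norm[OF assms order.refl] norm_ge_zero order.trans by blast

lemma norm_left_limit_le_sup_norm:
  assumes "admissible_input t0 u" "t0 < t"
  shows "norm (left_limit u t) \<le> sup_norm t0 u"
proof -
  have "(u \<longlongrightarrow> left_limit u t) (at_left t)"
    using assms by (intro left_limit_tendsto) (auto simp: admissible_input_def)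
  moreover have "\<forall>\<^sub>F s in at_left t. norm (u s) \<le> sup_norm t0 u"
    unfolding eventually_at_left_field
    using assms(2) norm_le_sup_norm[OF assms(1)] by (intro exI[of _ t0]) auto
  ultimately show ?thesis by (intro Lim_norm_ubound) auto
qed

text \<open>One negligible set collects the times where the differential equation fails and the
  countably many impulses. If the final level exceeds \<open>c\<close>, then so do all levels on
  \<open>{s..t}\<close>, and there the Lyapunov decrease applies, as \<open>c\<close> dominates the
  input.\<close>

lemma solution_flow:
  fixes x :: "real \<Rightarrow> real^'n" and u :: "real \<Rightarrow> real^'m"
  assumes V: "smooth V"
    and F: "\<And>r. 0 < r \<Longrightarrow> (F has_real_derivative 1 / \<phi> r) (at r)" "strict_mono_on {0<..} F"
    and \<phi>: "continuous_on {0<..} \<phi>" "\<And>r. 0 < r \<Longrightarrow> 0 < \<phi> r"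
    and decr: "\<And>x u. chi (norm u) \<le> V x \<Longrightarrow> grad V x \<bullet> f (x, u) \<le> - \<phi> (V x)"
    and u: "\<And>t. t0 \<le> t \<Longrightarrow> chi (norm (u t)) \<le> c" and c: "0 \<le> c"
    and sol: "is_solution t0 f g T u x0 x" and T: "countable T"
    and st: "t0 \<le> s" "s \<le> t" "{s<..t} \<inter> T = {}"
  shows "V (x t) \<le> c \<or> c < V (x s) \<and> F (V (x t)) \<le> F (V (x s)) - (t - s)"
proof -
  have ac: "absolutely_continuous_on_Icc r t x" if "s \<le> r" "r \<le> t" for r
  proof -
    have "t0 \<le> r \<and> r \<le> t \<and> {r<..t} \<inter> T = {}"
      using st that by (auto simp: disjoint_iff)
    then show ?thesis using sol unfolding is_solution_def by blast
  qed
  have "AE t in lebesgue. t \<in> {t0..} - T \<longrightarrow> (x has_vector_derivative f (x t, u t)) (at t)"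
    using sol unfolding is_solution_def by blast
  then obtain N where N: "N \<in> null_sets lebesgue"
    "{t \<in> space lebesgue. \<not> (t \<in> {t0..} - T \<longrightarrow> (x has_vector_derivative f (x t, u t)) (at t))} \<subseteq> N"
    unfolding eventually_ae_filter by blast
  have negl: "negligible (N \<union> T)"
    using N(1) countable_imp_null_set_lborel[OF T]
    by (auto simp: negligible_iff_null_sets null_sets_completionI)
  have der: "(x has_vector_derivative f (x r, u r)) (at r)" if "t0 \<le> r" "r \<notin> N \<union> T" for r
    using N(2) that by auto
  have flow: "F (V (x t)) \<le> F (V (x r)) - (t - r)" if r: "r \<in> {s..t}" "\<forall>q\<in>{r..t}. c < V (x q)" for r
  proof (rule flow_increment_le[OF V F(1) \<phi> ac _ negl])
    show "s \<le> r" "r \<le> t" "r \<le> t" using r(1) by auto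
    fix q assume q: "q \<in> {r..t} - (N \<union> T)"
    then show "(x has_vector_derivative f (x q, u q)) (at q)" using der[of q] r(1) st(1) by auto
    have "chi (norm (u q)) \<le> V (x q)"
      using u[of q] q r st(1) by (intro order.trans[OF u]) (auto intro: less_imp_le)
    then show "grad V (x q) \<bullet> f (x q, u q) \<le> - \<phi> (V (x q))" by (rule decr)
  qed (use r(2) c in force)+
  have "continuous_on {s..t} x"
    by (rule absolutely_continuous_on_Icc_imp_continuous_on) (use ac st(2) in auto)
  moreover have "continuous_on UNIV V"
    using smooth_isCont[OF V] by (simp add: continuous_on_eq_continuous_at)
  ultimately have cont: "continuous_on {s..t} (\<lambda>r. V (x r))"
    using continuous_on_compose2 by blast
  have "c < V (x q)" if "c < V (x t)" "q \<in> {s..t}" for q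
    by (rule flow_stays_above[OF F(2) c cont flow that])
  then show ?thesis using flow[of s] st(2) by (cases "c < V (x t)") auto
qed

text \<open>If \<open>c < w\<close>, then \<open>v\<close> exceeds \<open>c\<close> shortly before
  \<open>t\<close>, which rules out the first alternative there; the second one passes to the limit
  because \<open>F\<close> is continuous at \<open>w\<close>.\<close>

lemma solution_flow_left_limit:
  fixes v F :: "real \<Rightarrow> real"
  assumes F: "continuous_on {0<..} F" and c: "0 \<le> c"
    and lim: "(v \<longlongrightarrow> w) (at_left t)" and st: "s < t"
    and flow: "\<And>r. s \<le> r \<Longrightarrow> r < t \<Longrightarrow> v r \<le> c \<or> c < v s \<and> F (v r) \<le> F (v s) - (r - s)"
  shows "w \<le> c \<or> c < v s \<and> F w \<le> F (v s) - (t - s)"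
proof (cases "w \<le> c")
  case False
  then have w: "c < w" by simp
  have near: "\<forall>\<^sub>F r in at_left t. s \<le> r \<and> r < t"
    unfolding eventually_at_left_field using st by (intro exI[of _ s]) auto
  have "\<forall>\<^sub>F r in at_left t. c < v r" using lim w by (rule order_tendstoD)
  with near have ev: "\<forall>\<^sub>F r in at_left t. c < v s \<and> F (v r) \<le> F (v s) - (r - s)"
    by eventually_elim (use flow in force)
  then have "c < v s" using eventually_happens'[OF trivial_limit_at_left_real] by blast
  moreover have "isCont F w" using F w c by (simp add: continuous_on_eq_continuous_at)
  then have "((\<lambda>r. F (v r)) \<longlongrightarrow> F w) (at_left t)" by (rule isCont_tendsto_compose[OF _ lim])
  then have "F w \<le> F (v s) - (t - s)"
    by (rule tendsto_le[OF trivial_limit_at_left_real _ _ eventually_mono[OF ev], rotated])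
       (auto intro!: tendsto_intros)
  ultimately show ?thesis by blast
qed simp

theorem theorem1:
  fixes f g :: "(real^'n) \<times> (real^'m) \<Rightarrow> real^'n"
    and V :: "real^'n \<Rightarrow> real"
    and \<phi> \<alpha> :: "real \<Rightarrow> real"
    and t0 \<theta> \<delta> :: real
  assumes f_lipschitz: "\<And>u. local_lipschitz {u} UNIV (\<lambda>w x. f (x, w))"
    and f_zero: "f (0, 0) = 0"
    and g_zero: "g (0, 0) = 0"
    and g_continuous_at_zero: "continuous (at (0, 0)) g"
    and g_locally_bounded: "\<And>B. bounded B \<Longrightarrow> bounded (g ` B)"
    and lyapunov: "ISS_Lyapunov_function f g V \<phi> \<alpha>"
    and phi_P: "class_P \<phi>"
    and theta_pos: "\<theta> > 0"
    and delta_pos: "\<delta> > 0"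
    and dwell: "\<And>a. a > 0 \<Longrightarrow> (LBINT s=a..\<alpha> a. 1 / \<phi> s) \<le> \<theta> - \<delta>"
  shows "\<forall>T. impulse_time_sequence t0 T \<and> T \<in> dwell_time_sequences t0 \<theta>
           \<longrightarrow> input_to_state_stable t0 f g T"
proof (intro allI impI)
  fix T assume "impulse_time_sequence t0 T \<and> T \<in> dwell_time_sequences t0 \<theta>"
  then obtain \<tau> :: "nat \<Rightarrow> real" where T: "T = range \<tau>"
    and \<tau>: "\<And>i. t0 \<le> \<tau> i" "\<And>i. \<tau> (Suc i) - \<tau> i \<ge> \<theta>"
    unfolding dwell_time_sequences_def by blast
  from lyapunov obtain \<psi>1 \<psi>2 chi where V: "smooth V" "\<And>x. 0 \<le> V x"
    and \<psi>: "class_Kinf \<psi>1" "class_Kinf \<psi>2"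
    and sandwich: "\<And>x. \<psi>1 (norm x) \<le> V x" "\<And>x. V x \<le> \<psi>2 (norm x)"
    and \<alpha>P: "class_P \<alpha>" and chi: "class_Kinf chi"
    and flow: "\<And>x u. chi (norm u) \<le> V x \<Longrightarrow> grad V x \<bullet> f (x, u) \<le> - \<phi> (V x)"
    and jump: "\<And>x u. chi (norm u) \<le> V x \<Longrightarrow> V (g (x, u)) \<le> \<alpha> (V x)"
    unfolding ISS_Lyapunov_function_def by blast
  have contV: "isCont V x" for x
    by (rule smooth_isCont[OF V(1)])
  have V_0: "V 0 = 0" using sandwich(2)[of 0] V(2)[of 0] class_Kinf_zero[OF \<psi>(2)] by simp

  \<comment> \<open>The antiderivative of \<open>1 / \<phi>\<close> and the dwell-time
    condition\<close>
  have \<phi>: "continuous_on {0<..} \<phi>" "\<And>r. 0 < r \<Longrightarrow> 0 < \<phi> r"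
    using phi_P continuous_on_subset[of "{0..}" \<phi> "{0<..}"] unfolding class_P_def
    by (auto simp: subset_eq)
  have \<phi>_inv: "continuous_on {0<..} (\<lambda>s. 1 / \<phi> s)"
    by (intro continuous_intros \<phi>(1)) (use \<phi>(2) in force)
  \<comment> \<open>The open interval from 0 to infinity in the extended reals yields a single
    antiderivative on all positive numbers.\<close>
  have "\<exists>F. \<forall>r::real. 0 < ereal r \<longrightarrow> ereal r < \<infinity> \<longrightarrow> (F has_vector_derivative 1 / \<phi> r) (at r)"
    by (rule einterval_antiderivative) (use \<phi>_inv in \<open>auto simp: continuous_on_eq_continuous_at\<close>)
  then obtain F where F: "(F has_real_derivative 1 / \<phi> r) (at r)" if "0 < r" for r
    by (auto simp: has_real_derivative_iff_has_vector_derivative)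
  have F_mono: "strict_mono_on {0<..} F"
  proof (rule strict_mono_onI)
    fix r s :: real assume "r \<in> {0<..}" "s \<in> {0<..}" and rs: "r < s"
    have "\<exists>y. (F has_real_derivative y) (at q) \<and> y > 0" if "r \<le> q" "q \<le> s" for q
      using F[of q] \<phi>(2)[of q] that \<open>r \<in> {0<..}\<close> by (intro exI[of _ "1 / \<phi> q"]) auto
    then show "F r < F s" by (rule DERIV_pos_imp_increasing[OF rs])
  qed
  have F_cont: "continuous_on {0<..} F"
    using F DERIV_isCont by (auto simp: continuous_on_eq_continuous_at)
  \<comment> \<open>Shrinking \<open>\<delta>\<close> to at most \<open>\<theta>\<close> only
    weakens the dwell-time bound and makes \<open>\<delta>' / \<theta>\<close> at most 1.\<close>
  define \<delta>' where "\<delta>' = min \<delta> \<theta>"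
  have \<delta>': "0 < \<delta>'" "\<delta>' \<le> \<theta>" "\<delta>' \<le> \<delta>" using theta_pos delta_pos by (auto simp: \<delta>'_def)
  have \<alpha>_pos: "0 < \<alpha> a" if "0 < a" for a using \<alpha>P that by (simp add: class_P_def)
  have \<alpha>_F: "F (\<alpha> a) \<le> F a + (\<theta> - \<delta>')" if a: "0 < a" for a
  proof -
    \<comment> \<open>\<open>\<alpha> a\<close> may lie below \<open>a\<close>, in which case the
      integral is oriented backwards; hence the minimum and maximum below.\<close>
    have pos: "0 < min a (\<alpha> a)" using a \<alpha>_pos by simp
    have "(LBINT s=a..\<alpha> a. 1 / \<phi> s) = F (\<alpha> a) - F a"
    proof (rule interval_integral_FTC_finite)
      show "continuous_on {min a (\<alpha> a)..max a (\<alpha> a)} (\<lambda>s. 1 / \<phi> s)"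
        by (rule continuous_on_subset[OF \<phi>_inv]) (use pos in auto)
      fix s assume "min a (\<alpha> a) \<le> s"
      then have "(F has_real_derivative 1 / \<phi> s) (at s)" by (intro F less_le_trans[OF pos])
      then show "(F has_vector_derivative 1 / \<phi> s) (at s within {min a (\<alpha> a)..max a (\<alpha> a)})"
        unfolding has_real_derivative_iff_has_vector_derivative by (rule has_vector_derivative_at_within)
    qed
    with dwell[OF a] \<delta>'(3) show ?thesis by simp
  qed

  \<comment> \<open>Controls jumps from levels below \<open>c\<close>, where \<open>\<alpha>\<close>
    gives no bound. Boundedness of \<open>g\<close> on bounded sets makes the majorant finite, and
    continuity at 0 makes it vanish there.\<close>
  obtain \<gamma>g where \<gamma>g: "class_Kinf \<gamma>g" and V_g: "\<And>p. V (g p) \<le> \<gamma>g (norm p)"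
  proof (rule class_Kinf_majorant[of norm "\<lambda>p. V (g p)"])
    fix R :: real
    obtain B where "\<forall>y\<in>g ` cball 0 R. norm y \<le> B"
      using g_locally_bounded[OF bounded_cball[of 0 R]] unfolding bounded_iff by blast
    then have B: "norm (g p) \<le> B" if "norm p \<le> R" for p using that by auto
    have "V (g p) \<le> \<psi>2 \<bar>B\<bar>" if "norm p \<le> R" for p
      using B[OF that] class_Kinf_le_iff[OF \<psi>(2), of "norm (g p)" "\<bar>B\<bar>"]
      by (intro order.trans[OF sandwich(2)]) auto
    then show "\<exists>B. \<forall>p. norm p \<le> R \<longrightarrow> V (g p) \<le> B" by blast
  next
    fix e :: real assume e: "e > 0"
    have "isCont (\<lambda>p. V (g p)) 0"
      using isCont_o2[OF g_continuous_at_zero contV] by (simp add: zero_prod_def)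
    then obtain d where d: "d > 0" "\<And>p. dist p 0 < d \<Longrightarrow> dist (V (g p)) (V (g 0)) < e"
      unfolding continuous_at_eps_delta using e by blast
    have "V (g 0) = 0" using g_zero V_0 by (simp add: zero_prod_def)
    then have "V (g p) \<le> e" if "norm p \<le> d / 2" for p
      using d(2)[of p] that d(1) by (simp add: dist_real_def)
    then show "\<exists>d>0. \<forall>p. norm p \<le> d \<longrightarrow> V (g p) \<le> e" using d(1) by (intro exI[of _ "d / 2"]) auto
  qed auto

  \<comment> \<open>\<open>\<alpha>\<close> need not be monotone, so it is replaced by a class Kinf
    majorant. The absolute value restricts it to the half-line, where alone its values
    matter.\<close>
  obtain \<gamma>\<alpha> where \<gamma>\<alpha>: "class_Kinf \<gamma>\<alpha>" and \<alpha>_le: "\<And>r. \<alpha> \<bar>r\<bar> \<le> \<gamma>\<alpha> \<bar>r\<bar>"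
  proof (rule class_Kinf_majorant[of abs "\<lambda>r. \<alpha> \<bar>r\<bar>"])
    fix R :: real
    have "continuous_on {0..R} \<alpha>"
      using \<alpha>P continuous_on_subset[of "{0..}" \<alpha> "{0..R}"] by (auto simp: class_P_def)
    then have "bounded (\<alpha> ` {0..R})" by (intro compact_imp_bounded compact_continuous_image) auto
    then obtain B where B: "\<forall>y\<in>\<alpha> ` {0..R}. norm y \<le> B" unfolding bounded_iff by blast
    have "\<alpha> \<bar>r\<bar> \<le> B" if "\<bar>r\<bar> \<le> R" for r using bspec[OF B, of "\<alpha> \<bar>r\<bar>"] that by auto
    then show "\<exists>B. \<forall>r. \<bar>r\<bar> \<le> R \<longrightarrow> \<alpha> \<bar>r\<bar> \<le> B" by blast
  next
    fix e :: real assume e: "e > 0"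
    have "continuous (at 0 within {0..}) \<alpha>" "\<alpha> 0 = 0"
      using \<alpha>P by (auto simp: class_P_def continuous_on_eq_continuous_within)
    then obtain d where d: "d > 0" "\<And>r. r \<ge> 0 \<Longrightarrow> \<bar>r\<bar> < d \<Longrightarrow> \<bar>\<alpha> r\<bar> < e"
      unfolding continuous_within_eps_delta using e by (auto simp: dist_real_def)
    have "\<alpha> \<bar>r\<bar> \<le> e" if "\<bar>r\<bar> \<le> d / 2" for r using d(2)[of "\<bar>r\<bar>"] that d(1) by auto
    then show "\<exists>d>0. \<forall>r. \<bar>r\<bar> \<le> d \<longrightarrow> \<alpha> \<bar>r\<bar> \<le> e" using d(1) by (intro exI[of _ "d / 2"]) auto
  qed auto
  \<comment> \<open>\<open>A\<close> dominates the state before the first impulse through the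
    summand \<open>r\<close> and the state after it through \<open>\<gamma>\<alpha>\<close>.\<close>
  define A where "A r = r + \<gamma>\<alpha> r" for r
  have A: "class_Kinf A" unfolding A_def by (intro class_Kinf_add class_Kinf_id \<gamma>\<alpha>)
  have A_ge: "a \<le> A a" if "0 \<le> a" for a using class_Kinf_nonneg[OF \<gamma>\<alpha> that] by (simp add: A_def)
  have \<alpha>_A: "\<alpha> a \<le> A b" if "0 < a" "a \<le> b" for a b
    using \<alpha>_le[of a] class_Kinf_le_iff[OF \<gamma>\<alpha>, of a b] that by (simp add: A_def)

  \<comment> \<open>The class KL bound, from levels of \<open>V\<close> back to norms\<close>
  obtain \<sigma> where \<sigma>: "class_Kinf \<sigma>" and \<sigma>\<psi>: "\<And>r. 0 \<le> r \<Longrightarrow> \<sigma> (\<psi>1 r) = r"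
    using class_Kinf_inverse[OF \<psi>(1)] by blast
  have norm_le: "norm x \<le> \<sigma> r" if "V x \<le> r" for x r
    using class_Kinf_le_iff[OF \<sigma>, of "\<psi>1 (norm x)" r] sandwich(1)[of x] V(2)[of x] that
      class_Kinf_nonneg[OF \<psi>(1), of "norm x"] \<sigma>\<psi>[of "norm x"] by auto
  obtain b :: "real \<Rightarrow> real \<Rightarrow> real" where
    b_cont1: "\<And>s. 0 \<le> s \<Longrightarrow> continuous_on {0..} (\<lambda>a. b a s)" and b_0: "\<And>s. b 0 s = 0"
    and b_mono: "\<And>a a' s. 0 \<le> a \<Longrightarrow> a \<le> a' \<Longrightarrow> b a s \<le> b a' s"
    and b_cont2: "\<And>a. continuous_on UNIV (b a)" and b_anti: "\<And>a s s'. s \<le> s' \<Longrightarrow> b a s' \<le> b a s"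
    and b_lim: "\<And>a. (b a \<longlongrightarrow> 0) at_top"
    and b_ge: "\<And>y a s. 0 < y \<Longrightarrow> y \<le> a \<Longrightarrow> F y \<le> F a - s \<Longrightarrow> y \<le> b a s"
    by (rule decay_bound_exists[OF F_cont strict_mono_on_imp_mono_on[OF F_mono]])
       (rule that; assumption)

  \<comment> \<open>The argument is the time elapsed since \<open>t0\<close>, so the shift by
    \<open>\<tau> 0 - t0\<close> starts the decay at the first impulse.\<close>
  define k where "k t = \<delta>' / \<theta> * max 0 (t - (\<tau> 0 - t0))" for t
  have \<kappa>: "0 \<le> \<delta>' / \<theta>" using \<delta>' by simp
  have k: "0 \<le> k t" "s \<le> t \<Longrightarrow> k s \<le> k t" for s t
    unfolding k_def using \<kappa> by (auto intro!: mult_left_mono mult_nonneg_nonneg simp del: times_divide_eq_left)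
  have k_cont: "continuous_on S k" for S
    unfolding k_def by (intro continuous_intros)
  have k_lim: "filterlim k at_top at_top"
  proof -
    have "filterlim (\<lambda>t. \<delta>' / \<theta> * (- (\<tau> 0 - t0) + t)) at_top at_top"
      using \<delta>' theta_pos
      by (intro filterlim_tendsto_pos_mult_at_top[OF tendsto_const]
          filterlim_tendsto_add_at_top[OF tendsto_const] filterlim_ident) auto
    then show ?thesis
      unfolding k_def
      by (rule filterlim_at_top_mono) (intro always_eventually allI mult_left_mono \<kappa>, simp)
  qed
  \<comment> \<open>Read from the inside: \<open>\<psi>2\<close> bounds the initial level of
    \<open>V\<close>, \<open>A\<close> allows for the first impulse, \<open>b\<close> applies the
    decay, and \<open>\<sigma>\<close> returns to the norm.\<close>
  define B where "B r t = \<sigma> (b (A (\<psi>2 r)) (k t))" for r t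
  have A\<psi>: "class_Kinf (\<lambda>r. A (\<psi>2 r))" by (rule class_Kinf_compose[OF A \<psi>(2)])
  have A\<psi>_nonneg: "0 \<le> A (\<psi>2 r)" if "0 \<le> r" for r by (rule class_Kinf_nonneg[OF A\<psi> that])
  have b_nonneg: "0 \<le> b a s" if "0 \<le> a" for a s using b_mono[of 0 a s] that b_0 by simp
  define \<beta> where "\<beta> r t = B r t + r / (1 + t)" for r t
  have KL: "class_KL \<beta>"
    unfolding \<beta>_def
  proof (rule class_KL_add_strict)
    fix t :: real assume "0 \<le> t"
    have "continuous_on {0..} (\<lambda>r. b (A (\<psi>2 r)) (k t))"
      by (rule continuous_on_compose2[OF b_cont1[OF k(1)] class_Kinf_continuous[OF A\<psi>]])
         (use A\<psi>_nonneg in auto)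
    then show "continuous_on {0..} (\<lambda>r. B r t)"
      unfolding B_def
      by (rule continuous_on_compose2[OF class_Kinf_continuous[OF \<sigma>]]) (use b_nonneg A\<psi>_nonneg in auto)
    show "B 0 t = 0"
      unfolding B_def using class_Kinf_zero[OF A\<psi>] class_Kinf_zero[OF \<sigma>] b_0 by simp
    fix r r' :: real assume r: "0 \<le> r" "r \<le> r'"
    then have "A (\<psi>2 r) \<le> A (\<psi>2 r')" using class_Kinf_le_iff[OF A\<psi>, of r r'] by simp
    then show "B r t \<le> B r' t"
      unfolding B_def using r A\<psi>_nonneg b_nonneg
      by (subst class_Kinf_le_iff[OF \<sigma>]) (auto intro!: b_mono)
  next
    fix r :: real assume r: "0 < r"
    show "continuous_on {0..} (B r)"
      unfolding B_def
      by (rule continuous_on_compose2[OF class_Kinf_continuous[OF \<sigma>]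
            continuous_on_compose2[OF b_cont2 k_cont]])
         (use b_nonneg A\<psi>_nonneg r in auto)
    show "B r t' \<le> B r t" if "t \<le> t'" for t t'
      unfolding B_def using r A\<psi>_nonneg b_nonneg k(2)[OF that]
      by (subst class_Kinf_le_iff[OF \<sigma>]) (auto intro!: b_anti)
    have lim: "((\<lambda>t. b (A (\<psi>2 r)) (k t)) \<longlongrightarrow> 0) at_top"
      by (rule filterlim_compose[OF b_lim k_lim])
    have "continuous (at 0 within {0..}) \<sigma>"
      using class_Kinf_continuous[OF \<sigma>] by (auto simp: continuous_on_eq_continuous_within)
    then have "((\<lambda>t. \<sigma> (b (A (\<psi>2 r)) (k t))) \<longlongrightarrow> \<sigma> 0) at_top"
      by (rule continuous_within_tendsto_compose'[OF _ _ lim]) (use b_nonneg A\<psi>_nonneg r in auto)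
    then show "(B r \<longlongrightarrow> 0) at_top"
      using class_Kinf_zero[OF \<sigma>] by (simp add: B_def[abs_def])
  qed

  \<comment> \<open>A state at level at most \<open>chi r\<close> has norm at most
    \<open>\<sigma> (chi r)\<close>, so together with an input of norm at most \<open>r\<close> it
    is mapped by \<open>g\<close> to a level bounded by the second summand. The first summand
    ensures that \<open>G\<close> is not below \<open>c\<close>.\<close>
  define G where "G r = chi r + \<gamma>g (\<sigma> (chi r) + r)" for r
  have G: "class_Kinf G"
    unfolding G_def
    by (intro class_Kinf_add chi class_Kinf_compose[OF \<gamma>g] class_Kinf_compose[OF \<sigma>] class_Kinf_id)
  define \<gamma> where "\<gamma> r = \<sigma> (G r)" for r
  have \<gamma>: "class_Kinf \<gamma>" unfolding \<gamma>_def by (rule class_Kinf_compose[OF \<sigma> G])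

  \<comment> \<open>The estimate along a single solution\<close>
  have "norm (x t) \<le> max (\<beta> (norm x0) (t - t0)) (\<gamma> (sup_norm t0 u))"
    if u: "admissible_input t0 u" and sol: "is_solution t0 f g T u x0 x" and t: "t0 \<le> t"
    for x0 u x t
  proof -
    define U where "U = sup_norm t0 u"
    \<comment> \<open>With this level, \<open>c \<le> V x\<close> implies the premise of the
      Lyapunov inequalities for every input value and every left limit of the input.\<close>
    define c where "c = chi U"
    have U: "0 \<le> U" unfolding U_def by (rule sup_norm_nonneg[OF u])
    have c: "0 \<le> c" unfolding c_def by (rule class_Kinf_nonneg[OF chi U])
    have chi_u: "chi (norm w) \<le> c" if "norm w \<le> U" for w :: "real^'m"
      unfolding c_def using class_Kinf_le_iff[OF chi, of "norm w" U] U that by simp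
    have rcll: "right_continuous_with_left_limits t0 x" and x0: "x t0 = x0"
      using sol unfolding is_solution_def by blast+
    have x_jump: "x (\<tau> i) = g (left_limit x (\<tau> i), left_limit u (\<tau> i))" if "t0 < \<tau> i" for i
      using sol that unfolding is_solution_def T by blast
    have u_left: "norm (left_limit u (\<tau> i)) \<le> U" if "t0 < \<tau> i" for i
      unfolding U_def by (rule norm_left_limit_le_sup_norm[OF u that])
    have v_flow: "V (x t) \<le> c \<or> c < V (x s) \<and> F (V (x t)) \<le> F (V (x s)) - (t - s)"
      if "t0 \<le> s" "s \<le> t" "{s<..t} \<inter> range \<tau> = {}" for s t
      by (rule solution_flow[OF V(1) F F_mono \<phi> flow _ c sol])
         (use that chi_u norm_le_sup_norm[OF u] in \<open>auto simp: T U_def\<close>)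
    have "V (x t) \<le> G U \<or> 0 < V (x t) \<and> V (x t) \<le> A (V (x t0)) \<and>
        F (V (x t)) \<le> F (A (V (x t0))) - \<delta>' / \<theta> * max 0 (t - \<tau> 0)"
    proof (rule hybrid_bound[where v = "\<lambda>t. V (x t)" and vm = "\<lambda>t. V (left_limit x t)"
          and F = F and \<tau> = \<tau> and \<alpha> = \<alpha> and A = A and G = "G U" and c = c,
          OF F_mono c \<delta>'(1,2) \<tau>(1) \<tau>(2) V(2) v_flow])
      fix s t assume st: "t0 \<le> s" "s < t" "{s<..<t} \<inter> range \<tau> = {}"
      have "((\<lambda>r. V (x r)) \<longlongrightarrow> V (left_limit x t)) (at_left t)"
        by (rule isCont_tendsto_compose[OF contV left_limit_tendsto[OF rcll]]) (use st in auto)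
      then show "V (left_limit x t) \<le> c \<or> c < V (x s) \<and> F (V (left_limit x t)) \<le> F (V (x s)) - (t - s)"
        by (rule solution_flow_left_limit[OF F_cont c _ st(2)]) (rule v_flow, use st in \<open>auto simp: disjoint_iff\<close>)
    next
      fix i assume i: "t0 < \<tau> i" and small: "V (left_limit x (\<tau> i)) \<le> c"
      let ?p = "(left_limit x (\<tau> i), left_limit u (\<tau> i))"
      have "norm ?p \<le> norm (left_limit x (\<tau> i)) + norm (left_limit u (\<tau> i))" by (rule norm_Pair_le)
      also have "\<dots> \<le> \<sigma> (chi U) + U"
        using norm_le[OF small] u_left[OF i] by (simp add: c_def)
      finally have "\<gamma>g (norm ?p) \<le> \<gamma>g (\<sigma> (chi U) + U)"
        by (subst class_Kinf_le_iff[OF \<gamma>g]) (use class_Kinf_nonneg[OF \<sigma> c] U in \<open>auto simp: c_def\<close>)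
      then show "V (x (\<tau> i)) \<le> G U"
        using V_g[of ?p] c unfolding x_jump[OF i] G_def c_def by simp
    next
      fix i assume i: "t0 < \<tau> i" and large: "c < V (left_limit x (\<tau> i))"
      then show "V (x (\<tau> i)) \<le> \<alpha> (V (left_limit x (\<tau> i)))"
        unfolding x_jump[OF i] using chi_u[OF u_left[OF i]] by (intro jump) simp
    next
      show "c \<le> G U"
        using class_Kinf_nonneg[OF \<gamma>g] class_Kinf_nonneg[OF \<sigma> c] U by (simp add: G_def c_def)
    qed (use \<alpha>_pos \<alpha>_F A_ge \<alpha>_A t in auto)
    then show ?thesis
    proof
      assume "V (x t) \<le> G U"
      then have "norm (x t) \<le> \<gamma> U" unfolding \<gamma>_def by (rule norm_le)
      then show ?thesis by (simp add: U_def)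
    next
      assume *: "0 < V (x t) \<and> V (x t) \<le> A (V (x t0)) \<and>
        F (V (x t)) \<le> F (A (V (x t0))) - \<delta>' / \<theta> * max 0 (t - \<tau> 0)"
      then have "V (x t) \<le> b (A (V (x t0))) (k (t - t0))"
        by (intro b_ge) (auto simp: k_def)
      also have "\<dots> \<le> b (A (\<psi>2 (norm x0))) (k (t - t0))"
      proof (rule b_mono)
        show "0 \<le> A (V (x t0))" by (rule class_Kinf_nonneg[OF A V(2)])
        show "A (V (x t0)) \<le> A (\<psi>2 (norm x0))"
          using class_Kinf_le_iff[OF A, of "V x0" "\<psi>2 (norm x0)"] sandwich(2)[of x0] V(2)[of x0]
          by (simp add: x0)
      qed
      finally have "norm (x t) \<le> B (norm x0) (t - t0)" unfolding B_def by (rule norm_le)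
      moreover have "0 \<le> norm x0 / (1 + (t - t0))" using t by simp
      ultimately show ?thesis unfolding \<beta>_def by (intro max.coboundedI1) linarith
    qed
  qed
  with KL \<gamma> show "input_to_state_stable t0 f g T"
    unfolding input_to_state_stable_def by blast
qed

end
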